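(* Let $\bar x\in\mathbb{R}^n$ be an M-stationary point of (MPCC) where MPCC-LICQ holds. Furthermore, assume that MPCC-SSOC holds at $\bar x$ with respect to the multipliers $(\bar\lambda,\bar\eta,\bar\mu,\bar\nu)\in\Lambda^{\mathrm M}(\bar x)$. Set $\bar z:=(\bar x,\bar\lambda,\bar\eta,\bar\mu,\bar\nu)$. Then there exists $\delta>0$ such that the nonsmooth Newton method $$z_{k+1}:=z_k-DF(z_k)^{-1}F(z_k),\qquad k=0,1,\ldots,$$ is well defined for each initial iterate $z_0\in B_\delta(\bar z)$, while the associated sequence of iterates converges superlinearly to $\bar z$. If, additionally, the second-order derivatives of the data functions $f$, $g$, $h$, $G$, and $H$ are locally Lipschitz continuous, then the convergence is quadratic.
   Context: **Problem.** Let $f\colon\mathbb{R}^n\to\mathbb{R}$, $g\colon\mathbb{R}^n\to\mathbb{R}^\ell$, $h\colon\mathbb{R}^n\to\mathbb{R}^m$, $G,H\colon\mathbb{R}^n\to\mathbb{R}^p$ be twice continuously differentiable. (MPCC) is the problem of minimizing $f(x)$ subject to $g(x)\le 0$, $h(x)=0$, $G(x)\ge 0$, $H(x)\ge 0$, $G(x)^\top H(x)=0$. Put $I^\ell=\{1,\dots,\ell\}$, $I^p=\{1,\dots,p\}$. For a matrix $V$ and a set $I$ of row indices, $V_I$ is the matrix of the rows of $V$ with index in $I$ (similarly for vectors); $[v_i]_I$ is the matrix (or vector) obtained by stacking the blocks $v_i$, $i\in I$. $B_\varepsilon(z)$ is the closed $\varepsilon$-ball around $z$. The Lagrangian is $\mathcal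 L(x,\lambda,\eta,\mu,\nu)=f(x)+\lambda^\top g(x)+\eta^\top h(x)+\mu^\top G(x)+\nu^\top H(x)$. **Index sets.** For $\bar x$ feasible: $I^g(\bar x)=\{i\in I^\ell: g_i(\bar x)=0\}$, $I^{+0}(\bar x)=\{i\in I^p:G_i(\bar x)>0, H_i(\bar x)=0\}$, $I^{0+}(\bar x)=\{i\in I^p:G_i(\bar x)=0,H_i(\bar x)>0\}$, $I^{00}(\bar x)=\{i\in I^p:G_i(\bar x)=H_i(\bar x)=0\}$. For $\mu,\nu\in\mathbb{R}^p$: $I^{00}_{\pm\mathbb R}(\bar x,\mu,\nu)=\{i\in I^{00}(\bar x):\mu_i\ne 0\}$, $I^{00}_{\mathbb R\pm}(\bar x,\mu,\nu)=\{i\in I^{00}(\bar x):\nu_i\neq 0\}$, $I^{00}_{00}(\bar x,\mu,\nu)=\{i\in I^{00}(\bar x):\mu_i=\nu_i=0\}$. **M-stationarity.** A feasible point $\bar x$ is M-stationary if there are $\lambda\in\mathbb{R}^\ell,\eta\in\mathbb{R}^m,\mu,\nu\in\mathbb{R}^p$ with $\nabla_x\mathcal L(\bar x,\lambda,\eta,\mu,\nu)=0$; $\lambda_{I^g(\bar x)}\ge0$, $\lambda_{I^\ell\setminus I^g(\bar x)}=0$; $\mu_{I^{+0}(\bar x)}=0$; $\nu_{I^{0+}(\bar x)}=0$; and for all $i\in I^{00}(\bar x)$: $\mu_i\nu_i=0$ or ($\mu_i<0$ and $\nu_i<0$). $\Lambda^{\mathrm M}(\bar x)$ is the set of all such $(\lambda,\eta,\mu,\nu)$.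 **MPCC-LICQ** holds at $\bar x$ if the matrix obtained by stacking $g'(\bar x)_{I^g(\bar x)}$, $h'(\bar x)$, $G'(\bar x)_{I^{0+}(\bar x)\cup I^{00}(\bar x)}$, $H'(\bar x)_{I^{+0}(\bar x)\cup I^{00}(\bar x)}$ has full row rank. **MPCC-SSOC** holds at an M-stationary point $\bar x$ w.r.t. $(\lambda,\eta,\mu,\nu)\in\Lambda^{\mathrm M}(\bar x)$ if $\delta x^\top\nabla^2_{xx}\mathcal L(\bar x,\lambda,\eta,\mu,\nu)\,\delta x>0$ for all $\delta x\in S(\bar x,\lambda,\mu,\nu)\setminus\{0\}$, where $S(\bar x,\lambda,\mu,\nu)$ is the set of $\delta x\in\mathbb{R}^n$ with: $\nabla g_i(\bar x)^\top\delta x=0$ for $i\in I^g(\bar x)$ with $\lambda_i>0$; $h'(\bar x)\delta x=0$; $\nabla G_i(\bar x)^\top\delta x=0$ for $i\in I^{0+}(\bar x)\cup I^{00}_{\pm\mathbb R}(\bar x,\mu,\nu)$; $\nabla H_i(\bar x)^\top\delta x=0$ for $i\in I^{+0}(\bar x)\cup I^{00}_{\mathbb R\pm}(\bar x,\mu,\nu)$; $(\nabla G_i(\bar x)^\top\delta x)(\nabla H_i(\bar x)^\top\delta x)=0$ for $i\in I^{00}_{00}(\bar x,\mu,\nu)$. **The function $\varphi$ and its Newton derivative.** For $w=(a,b,\mu,\nu)\in\mathbb{R}^4$ let $\psi_1(w)=\max(-a,|b|,|\mu|)$, $\psi_2(w)=\max(-b,|a|,|\nu|)$, $\psi_3(w)=\max(|a|,|b|,\mu,\nu)$,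 $\varphi_1(w)=\min(\psi_1(w),\psi_2(w),\psi_3(w))$. Let $\sigma(s)=1$ if $s\ge0$ and $\sigma(s)=-1$ if $s<0$. $D\varphi_1(w)\in\mathbb{R}^{1\times4}$ is defined as follows (priority to first-listed entries): let $i$ be the smallest index with $\psi_i(w)=\varphi_1(w)$, and take the first argument of the maximum defining $\psi_i(w)$ which attains this maximum, where the arguments are ordered as $-a,|b|,|\mu|$ for $i=1$, as $-b,|a|,|\nu|$ for $i=2$, and as $|a|,|b|,\mu,\nu$ for $i=3$; $D\varphi_1(w)$ is $-e_1^\top$, $\sigma(a)e_1^\top$, $-e_2^\top$, $\sigma(b)e_2^\top$, $e_3^\top$, $\sigma(\mu)e_3^\top$, $e_4^\top$, $\sigma(\nu)e_4^\top$ if this argument is $-a$, $|a|$, $-b$, $|b|$, $\mu$, $|\mu|$, $\nu$, $|\nu|$, respectively. Further: - if $D\varphi_1(w)=\pm e_1^\top$: $\varphi_2(w)=\min(|b|,|\nu|)$, and $D\varphi_2(w)=\sigma(b)e_2^\top$ if $|b|\le|\nu|$, else $\sigma(\nu)e_4^\top$; - if $D\varphi_1(w)=\pm e_2^\top$: $\varphi_2(w)=\min(|a|,|\mu|)$, and $D\varphi_2(w)=\sigma(a)e_1^\top$ if $|a|\le|\mu|$, else $\sigma(\mu)e_3^\top$; - if $D\varphi_1(w)=\pm e_3^\top$: $\varphi_2(w)=|b|$, $D\varphi_2(w)=\sigma(b)e_2^\top$; - if $D\varphi_1(w)=\pm e_4^\top$: $\varphi_2(w)=|a|$, $D\varphi_2(w)=\sigma(a)e_1^\top$.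 Put $\varphi=(\varphi_1,\varphi_2)\colon\mathbb{R}^4\to\mathbb{R}^2$ and let $D\varphi(w)\in\mathbb{R}^{2\times4}$ have rows $D\varphi_1(w),D\varphi_2(w)$; its columns are denoted $D_a\varphi,D_b\varphi,D_\mu\varphi,D_\nu\varphi$. Let $\pi_{\min}(a,b)=\min(a,b)$ with $D\pi_{\min}(a,b)=(D_a\pi_{\min},D_b\pi_{\min})=(1,0)$ if $a\le b$ and $(0,1)$ otherwise. **The map $F$ and $DF$.** For $z=(x,\lambda,\eta,\mu,\nu)\in\mathbb{R}^{n+\ell+m+2p}$, $$F(z)=\begin{bmatrix}\nabla_x\mathcal L(z)\\ [\pi_{\min}(-g_i(x),\lambda_i)]_{I^\ell}\\ h(x)\\ [\varphi(G_i(x),H_i(x),\mu_i,\nu_i)]_{I^p}\end{bmatrix},\qquad DF(z)=\begin{bmatrix}\nabla^2_{xx}\mathcal L(z)&g'(x)^\top&h'(x)^\top&G'(x)^\top&H'(x)^\top\\ A_1(z)&A_2(z)&0&0&0\\ h'(x)&0&0&0&0\\ A_3(z)&0&0&A_4(z)&A_5(z)\end{bmatrix},$$ where, with $\pi_{\min}$ and its derivatives evaluated at $(-g_i(x),\lambda_i)$ and those of $\varphi$ at $(G_i(x),H_i(x),\mu_i,\nu_i)$, $A_1=[-D_a\pi_{\min}\nabla g_i(x)^\top]_{I^\ell}$, $A_2=[D_b\pi_{\min}e_i^\top]_{I^\ell}$, $A_3=[D_a\varphi\,\nabla G_i(x)^\top+D_b\varphi\,\nabla H_i(x)^\top]_{I^p}$,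 $A_4=[D_\mu\varphi\, e_i^\top]_{I^p}$, $A_5=[D_\nu\varphi\, e_i^\top]_{I^p}$. Superlinear convergence means $z_k\to\bar z$ and $\|z_{k+1}-\bar z\|=o(\|z_k-\bar z\|)$; quadratic convergence means $\|z_{k+1}-\bar z\|=O(\|z_k-\bar z\|^2)$. *)

theory Defs
  imports "HOL-Analysis.Analysis" "HOL-Library.Landau_Symbols"
begin

section \<open>Derivatives\<close>

text \<open>Gradients and Hessians are total functions, meaningful where the derivatives exist.
  For vector-valued maps \<^term>\<open>jacobian\<close> is the library's Jacobian.\<close>

definition grad :: "(real^'n \<Rightarrow> real) \<Rightarrow> real^'n \<Rightarrow> real^'n" where
  "grad u x = (\<chi> j. frechet_derivative u (at x) (axis j 1))"

lemma gderiv_grad: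
  assumes "u differentiable (at x)"
  shows "GDERIV u x :> grad u x"
proof -
  let ?D = "frechet_derivative u (at x)"
  have D: "(u has_derivative ?D) (at x)"
    using assms by (simp add: frechet_derivative_works)
  then have lin: "linear ?D"
    by (rule has_derivative_linear)
  have "?D v = v \<bullet> grad u x" for v
  proof -
    have "?D v = ?D (\<Sum>j\<in>UNIV. (v $ j) *\<^sub>R axis j 1)"
      using basis_expansion[of v] by (simp add: scalar_mult_eq_scaleR)
    also have "\<dots> = (\<Sum>j\<in>UNIV. v $ j * ?D (axis j 1))"
      using lin by (simp add: linear_sum linear_cmul)
    finally show ?thesis
      by (simp add: grad_def inner_vec_def)
  qed
  then have "?D = (\<lambda>v. v \<bullet> grad u x)" ..
  with D show ?thesis
    by (simp add: gderiv_def)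
qed

definition hess :: "(real^'n \<Rightarrow> real) \<Rightarrow> real^'n \<Rightarrow> real^'n^'n" where
  "hess u x = jacobian (grad u) (at x)"

definition twice_cont_diff :: "(real^'n \<Rightarrow> real) \<Rightarrow> bool" where
  "twice_cont_diff u \<longleftrightarrow>
     (\<forall>x. u differentiable (at x)) \<and> (\<forall>x. grad u differentiable (at x)) \<and>
     continuous_on UNIV (hess u)"

definition twice_cont_diff_vec :: "(real^'n \<Rightarrow> real^'k) \<Rightarrow> bool" where
  "twice_cont_diff_vec u \<longleftrightarrow> (\<forall>i. twice_cont_diff (\<lambda>x. u x $ i))"

definition loc_lipschitz_hess :: "(real^'n \<Rightarrow> real) \<Rightarrow> bool" where
  "loc_lipschitz_hess u \<longleftrightarrow> (\<forall>x. \<exists>r>0. \<exists>C. C-lipschitz_on (cball x r) (hess u))"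

definition loc_lipschitz_hess_vec :: "(real^'n \<Rightarrow> real^'k) \<Rightarrow> bool" where
  "loc_lipschitz_hess_vec u \<longleftrightarrow> (\<forall>i. loc_lipschitz_hess (\<lambda>x. u x $ i))"

section \<open>The MPCC, stationarity and second-order condition\<close>

type_synonym ('n, 'l, 'm, 'p) primal_dual =
  "(real^'n) \<times> (real^'l) \<times> (real^'m) \<times> (real^'p) \<times> (real^'p)"

definition feasible ::
  "(real^'n \<Rightarrow> real^'l) \<Rightarrow> (real^'n \<Rightarrow> real^'m) \<Rightarrow> (real^'n \<Rightarrow> real^'p) \<Rightarrow> (real^'n \<Rightarrow> real^'p) \<Rightarrow>
    real^'n \<Rightarrow> bool" where
  "feasible g h G H x \<longleftrightarrow>
     (\<forall>i. g x $ i \<le> 0) \<and> h x = 0 \<and> (\<forall>i. G x $ i \<ge> 0) \<and> (\<forall>i. H x $ i \<ge> 0) \<and> G x \<bullet> H x = 0"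

definition Lagr ::
  "(real^'n \<Rightarrow> real) \<Rightarrow> (real^'n \<Rightarrow> real^'l) \<Rightarrow> (real^'n \<Rightarrow> real^'m) \<Rightarrow>
    (real^'n \<Rightarrow> real^'p) \<Rightarrow> (real^'n \<Rightarrow> real^'p) \<Rightarrow>
    real^'l \<Rightarrow> real^'m \<Rightarrow> real^'p \<Rightarrow> real^'p \<Rightarrow> real^'n \<Rightarrow> real" where
  "Lagr f g h G H lam \<eta> \<mu> \<nu> x = f x + lam \<bullet> g x + \<eta> \<bullet> h x + \<mu> \<bullet> G x + \<nu> \<bullet> H x"

definition I_g :: "(real^'n \<Rightarrow> real^'l) \<Rightarrow> real^'n \<Rightarrow> 'l set" where
  "I_g g x = {i. g x $ i = 0}"

definition I_p0 :: "(real^'n \<Rightarrow> real^'p) \<Rightarrow> (real^'n \<Rightarrow> real^'p) \<Rightarrow> real^'n \<Rightarrow> 'p set" where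
  "I_p0 G H x = {i. G x $ i > 0 \<and> H x $ i = 0}"

definition I_0p :: "(real^'n \<Rightarrow> real^'p) \<Rightarrow> (real^'n \<Rightarrow> real^'p) \<Rightarrow> real^'n \<Rightarrow> 'p set" where
  "I_0p G H x = {i. G x $ i = 0 \<and> H x $ i > 0}"

definition I_00 :: "(real^'n \<Rightarrow> real^'p) \<Rightarrow> (real^'n \<Rightarrow> real^'p) \<Rightarrow> real^'n \<Rightarrow> 'p set" where
  "I_00 G H x = {i. G x $ i = 0 \<and> H x $ i = 0}"

definition I_00_mu :: "(real^'n \<Rightarrow> real^'p) \<Rightarrow> (real^'n \<Rightarrow> real^'p) \<Rightarrow> real^'n \<Rightarrow> real^'p \<Rightarrow> 'p set"
  where "I_00_mu G H x \<mu> = {i \<in> I_00 G H x. \<mu> $ i \<noteq> 0}"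

definition I_00_nu :: "(real^'n \<Rightarrow> real^'p) \<Rightarrow> (real^'n \<Rightarrow> real^'p) \<Rightarrow> real^'n \<Rightarrow> real^'p \<Rightarrow> 'p set"
  where "I_00_nu G H x \<nu> = {i \<in> I_00 G H x. \<nu> $ i \<noteq> 0}"

definition I_00_00 ::
  "(real^'n \<Rightarrow> real^'p) \<Rightarrow> (real^'n \<Rightarrow> real^'p) \<Rightarrow> real^'n \<Rightarrow> real^'p \<Rightarrow> real^'p \<Rightarrow> 'p set"
  where "I_00_00 G H x \<mu> \<nu> = {i \<in> I_00 G H x. \<mu> $ i = 0 \<and> \<nu> $ i = 0}"

definition M_multipliers ::
  "(real^'n \<Rightarrow> real) \<Rightarrow> (real^'n \<Rightarrow> real^'l) \<Rightarrow> (real^'n \<Rightarrow> real^'m) \<Rightarrow>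
    (real^'n \<Rightarrow> real^'p) \<Rightarrow> (real^'n \<Rightarrow> real^'p) \<Rightarrow> real^'n \<Rightarrow>
    ((real^'l) \<times> (real^'m) \<times> (real^'p) \<times> (real^'p)) set" where
  "M_multipliers f g h G H x = {(lam, \<eta>, \<mu>, \<nu>).
     grad (Lagr f g h G H lam \<eta> \<mu> \<nu>) x = 0 \<and>
     (\<forall>i\<in>I_g g x. lam $ i \<ge> 0) \<and> (\<forall>i\<in>- I_g g x. lam $ i = 0) \<and>
     (\<forall>i\<in>I_p0 G H x. \<mu> $ i = 0) \<and> (\<forall>i\<in>I_0p G H x. \<nu> $ i = 0) \<and>
     (\<forall>i\<in>I_00 G H x. \<mu> $ i * \<nu> $ i = 0 \<or> \<mu> $ i < 0 \<and> \<nu> $ i < 0)}"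

definition M_stationary ::
  "(real^'n \<Rightarrow> real) \<Rightarrow> (real^'n \<Rightarrow> real^'l) \<Rightarrow> (real^'n \<Rightarrow> real^'m) \<Rightarrow>
    (real^'n \<Rightarrow> real^'p) \<Rightarrow> (real^'n \<Rightarrow> real^'p) \<Rightarrow> real^'n \<Rightarrow> bool" where
  "M_stationary f g h G H x \<longleftrightarrow> feasible g h G H x \<and> M_multipliers f g h G H x \<noteq> {}"

text \<open>Full row rank of the submatrix \<open>V\<^sub>I\<close>: its row rank is its number of rows
  (compare the fact \<open>row_rank_def\<close>); rows are counted by index, so a repeated row makes this fail.\<close>

definition full_row_rank_on :: "'r set \<Rightarrow> real^'n^'r \<Rightarrow> bool" where
  "full_row_rank_on I V \<longleftrightarrow> dim ((\<lambda>i. row i V) ` I) = card I"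

definition stacked_jacobian ::
  "(real^'n \<Rightarrow> real^'l) \<Rightarrow> (real^'n \<Rightarrow> real^'m) \<Rightarrow> (real^'n \<Rightarrow> real^'p) \<Rightarrow> (real^'n \<Rightarrow> real^'p) \<Rightarrow>
    real^'n \<Rightarrow> real^'n^('l + ('m + ('p + 'p)))" where
  "stacked_jacobian g h G H x = (\<chi> r. case r of
      Inl i \<Rightarrow> row i (jacobian g (at x))
    | Inr (Inl i) \<Rightarrow> row i (jacobian h (at x))
    | Inr (Inr (Inl i)) \<Rightarrow> row i (jacobian G (at x))
    | Inr (Inr (Inr i)) \<Rightarrow> row i (jacobian H (at x)))"

definition MPCC_LICQ ::
  "(real^'n \<Rightarrow> real^'l) \<Rightarrow> (real^'n \<Rightarrow> real^'m) \<Rightarrow> (real^'n \<Rightarrow> real^'p) \<Rightarrow> (real^'n \<Rightarrow> real^'p) \<Rightarrow>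
    real^'n \<Rightarrow> bool" where
  "MPCC_LICQ g h G H x \<longleftrightarrow>
     full_row_rank_on
       (I_g g x <+> (UNIV <+> ((I_0p G H x \<union> I_00 G H x) <+> (I_p0 G H x \<union> I_00 G H x))))
       (stacked_jacobian g h G H x)"

definition critical_directions ::
  "(real^'n \<Rightarrow> real^'l) \<Rightarrow> (real^'n \<Rightarrow> real^'m) \<Rightarrow> (real^'n \<Rightarrow> real^'p) \<Rightarrow> (real^'n \<Rightarrow> real^'p) \<Rightarrow>
    real^'n \<Rightarrow> real^'l \<Rightarrow> real^'p \<Rightarrow> real^'p \<Rightarrow> (real^'n) set" where
  "critical_directions g h G H x lam \<mu> \<nu> = {d.
     (\<forall>i\<in>I_g g x. lam $ i > 0 \<longrightarrow> grad (\<lambda>y. g y $ i) x \<bullet> d = 0) \<and>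
     jacobian h (at x) *v d = 0 \<and>
     (\<forall>i\<in>I_0p G H x \<union> I_00_mu G H x \<mu>. grad (\<lambda>y. G y $ i) x \<bullet> d = 0) \<and>
     (\<forall>i\<in>I_p0 G H x \<union> I_00_nu G H x \<nu>. grad (\<lambda>y. H y $ i) x \<bullet> d = 0) \<and>
     (\<forall>i\<in>I_00_00 G H x \<mu> \<nu>. (grad (\<lambda>y. G y $ i) x \<bullet> d) * (grad (\<lambda>y. H y $ i) x \<bullet> d) = 0)}"

definition MPCC_SSOC ::
  "(real^'n \<Rightarrow> real) \<Rightarrow> (real^'n \<Rightarrow> real^'l) \<Rightarrow> (real^'n \<Rightarrow> real^'m) \<Rightarrow>
    (real^'n \<Rightarrow> real^'p) \<Rightarrow> (real^'n \<Rightarrow> real^'p) \<Rightarrow>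
    real^'n \<Rightarrow> real^'l \<Rightarrow> real^'m \<Rightarrow> real^'p \<Rightarrow> real^'p \<Rightarrow> bool" where
  "MPCC_SSOC f g h G H x lam \<eta> \<mu> \<nu> \<longleftrightarrow>
     (\<forall>d \<in> critical_directions g h G H x lam \<mu> \<nu> - {0}.
        d \<bullet> (hess (Lagr f g h G H lam \<eta> \<mu> \<nu>) x *v d) > 0)"

section \<open>The function \<open>\<phi>\<close> and its Newton derivative\<close>

definition psi1 :: "real \<Rightarrow> real \<Rightarrow> real \<Rightarrow> real \<Rightarrow> real" where
  "psi1 a b \<mu> \<nu> = max (- a) (max \<bar>b\<bar> \<bar>\<mu>\<bar>)"

definition psi2 :: "real \<Rightarrow> real \<Rightarrow> real \<Rightarrow> real \<Rightarrow> real" where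
  "psi2 a b \<mu> \<nu> = max (- b) (max \<bar>a\<bar> \<bar>\<nu>\<bar>)"

definition psi3 :: "real \<Rightarrow> real \<Rightarrow> real \<Rightarrow> real \<Rightarrow> real" where
  "psi3 a b \<mu> \<nu> = max \<bar>a\<bar> (max \<bar>b\<bar> (max \<mu> \<nu>))"

definition phi1 :: "real \<Rightarrow> real \<Rightarrow> real \<Rightarrow> real \<Rightarrow> real" where
  "phi1 a b \<mu> \<nu> = min (psi1 a b \<mu> \<nu>) (min (psi2 a b \<mu> \<nu>) (psi3 a b \<mu> \<nu>))"

text \<open>Unlike \<^term>\<open>sgn\<close>, this takes the value \<open>1\<close> at \<open>0\<close>.\<close>

definition sig :: "real \<Rightarrow> real" where
  "sig s = (if s \<ge> 0 then 1 else - 1)"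

text \<open>The numeral \<open>4\<close> denotes the same index of type \<open>4\<close> as \<open>0\<close>;
  it is distinct from \<open>1\<close>, \<open>2\<close> and \<open>3\<close>.\<close>

definition unit4 :: "4 \<Rightarrow> real^4" where
  "unit4 k = axis k 1"

definition Dphi1 :: "real \<Rightarrow> real \<Rightarrow> real \<Rightarrow> real \<Rightarrow> real^4" where
  "Dphi1 a b \<mu> \<nu> =
    (if psi1 a b \<mu> \<nu> = phi1 a b \<mu> \<nu> then
       (if - a = psi1 a b \<mu> \<nu> then - unit4 1
        else if \<bar>b\<bar> = psi1 a b \<mu> \<nu> then sig b *\<^sub>R unit4 2
        else sig \<mu> *\<^sub>R unit4 3)
     else if psi2 a b \<mu> \<nu> = phi1 a b \<mu> \<nu> then
       (if - b = psi2 a b \<mu> \<nu> then - unit4 2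
        else if \<bar>a\<bar> = psi2 a b \<mu> \<nu> then sig a *\<^sub>R unit4 1
        else sig \<nu> *\<^sub>R unit4 4)
     else
       (if \<bar>a\<bar> = psi3 a b \<mu> \<nu> then sig a *\<^sub>R unit4 1
        else if \<bar>b\<bar> = psi3 a b \<mu> \<nu> then sig b *\<^sub>R unit4 2
        else if \<mu> = psi3 a b \<mu> \<nu> then unit4 3
        else unit4 4))"

text \<open>In the next two definitions the last branch is the case
  \<^term>\<open>Dphi1 a b \<mu> \<nu> \<in> {unit4 4, - unit4 4}\<close>.\<close>

definition phi2 :: "real \<Rightarrow> real \<Rightarrow> real \<Rightarrow> real \<Rightarrow> real" where
  "phi2 a b \<mu> \<nu> =
    (if Dphi1 a b \<mu> \<nu> \<in> {unit4 1, - unit4 1} then min \<bar>b\<bar> \<bar>\<nu>\<bar>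
     else if Dphi1 a b \<mu> \<nu> \<in> {unit4 2, - unit4 2} then min \<bar>a\<bar> \<bar>\<mu>\<bar>
     else if Dphi1 a b \<mu> \<nu> \<in> {unit4 3, - unit4 3} then \<bar>b\<bar>
     else \<bar>a\<bar>)"

definition Dphi2 :: "real \<Rightarrow> real \<Rightarrow> real \<Rightarrow> real \<Rightarrow> real^4" where
  "Dphi2 a b \<mu> \<nu> =
    (if Dphi1 a b \<mu> \<nu> \<in> {unit4 1, - unit4 1} then
       (if \<bar>b\<bar> \<le> \<bar>\<nu>\<bar> then sig b *\<^sub>R unit4 2 else sig \<nu> *\<^sub>R unit4 4)
     else if Dphi1 a b \<mu> \<nu> \<in> {unit4 2, - unit4 2} then
       (if \<bar>a\<bar> \<le> \<bar>\<mu>\<bar> then sig a *\<^sub>R unit4 1 else sig \<mu> *\<^sub>R unit4 3)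
     else if Dphi1 a b \<mu> \<nu> \<in> {unit4 3, - unit4 3} then sig b *\<^sub>R unit4 2
     else sig a *\<^sub>R unit4 1)"

definition phi :: "real \<Rightarrow> real \<Rightarrow> real \<Rightarrow> real \<Rightarrow> real^2" where
  "phi a b \<mu> \<nu> = vector [phi1 a b \<mu> \<nu>, phi2 a b \<mu> \<nu>]"

definition Dphi :: "real \<Rightarrow> real \<Rightarrow> real \<Rightarrow> real \<Rightarrow> real^4^2" where
  "Dphi a b \<mu> \<nu> = vector [Dphi1 a b \<mu> \<nu>, Dphi2 a b \<mu> \<nu>]"

definition pi_min :: "real \<Rightarrow> real \<Rightarrow> real" where
  "pi_min a b = min a b"

definition Da_pi_min :: "real \<Rightarrow> real \<Rightarrow> real" where
  "Da_pi_min a b = (if a \<le> b then 1 else 0)"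

definition Db_pi_min :: "real \<Rightarrow> real \<Rightarrow> real" where
  "Db_pi_min a b = (if a \<le> b then 0 else 1)"

section \<open>The nonsmooth Newton method\<close>

text \<open>The values of \<open>F\<close> are kept in block form: the last block is the stack, over the
  complementarity indices, of vectors in \<open>\<real>\<^sup>2\<close>. The product norms are the Euclidean ones.\<close>

type_synonym ('n, 'l, 'm, 'p) residual =
  "(real^'n) \<times> (real^'l) \<times> (real^'m) \<times> (real^2^'p)"

fun newton_F ::
  "(real^'n \<Rightarrow> real) \<Rightarrow> (real^'n \<Rightarrow> real^'l) \<Rightarrow> (real^'n \<Rightarrow> real^'m) \<Rightarrow>
    (real^'n \<Rightarrow> real^'p) \<Rightarrow> (real^'n \<Rightarrow> real^'p) \<Rightarrow>
    ('n, 'l, 'm, 'p) primal_dual \<Rightarrow> ('n, 'l, 'm, 'p) residual" where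
  "newton_F f g h G H (x, lam, \<eta>, \<mu>, \<nu>) =
    (grad (Lagr f g h G H lam \<eta> \<mu> \<nu>) x,
     (\<chi> i. pi_min (- (g x $ i)) (lam $ i)),
     h x,
     (\<chi> i. phi (G x $ i) (H x $ i) (\<mu> $ i) (\<nu> $ i)))"

definition outer :: "real^'r \<Rightarrow> real^'c \<Rightarrow> real^'c^'r" where
  "outer u v = (\<chi> i j. u $ i * v $ j)"

definition stacked_mv :: "real^'c^'r^'p \<Rightarrow> real^'c \<Rightarrow> real^'r^'p" where
  "stacked_mv A v = (\<chi> i. (A $ i) *v v)"

definition A1 :: "(real^'n \<Rightarrow> real^'l) \<Rightarrow> real^'n \<Rightarrow> real^'l \<Rightarrow> real^'n^'l" where
  "A1 g x lam = (\<chi> i. (- Da_pi_min (- (g x $ i)) (lam $ i)) *\<^sub>R grad (\<lambda>y. g y $ i) x)"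

definition A2 :: "(real^'n \<Rightarrow> real^'l) \<Rightarrow> real^'n \<Rightarrow> real^'l \<Rightarrow> real^'l^'l" where
  "A2 g x lam = (\<chi> i. Db_pi_min (- (g x $ i)) (lam $ i) *\<^sub>R axis i 1)"

text \<open>Columns \<open>1, 2, 3, 4\<close> of \<^term>\<open>Dphi a b \<mu> \<nu>\<close> are the partial derivatives with respect to
  \<open>a, b, \<mu>, \<nu>\<close>.\<close>

definition A3 :: "(real^'n \<Rightarrow> real^'p) \<Rightarrow> (real^'n \<Rightarrow> real^'p) \<Rightarrow>
    real^'n \<Rightarrow> real^'p \<Rightarrow> real^'p \<Rightarrow> real^'n^2^'p" where
  "A3 G H x \<mu> \<nu> = (\<chi> i.
     outer (column 1 (Dphi (G x $ i) (H x $ i) (\<mu> $ i) (\<nu> $ i))) (grad (\<lambda>y. G y $ i) x) +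
     outer (column 2 (Dphi (G x $ i) (H x $ i) (\<mu> $ i) (\<nu> $ i))) (grad (\<lambda>y. H y $ i) x))"

definition A4 :: "(real^'n \<Rightarrow> real^'p) \<Rightarrow> (real^'n \<Rightarrow> real^'p) \<Rightarrow>
    real^'n \<Rightarrow> real^'p \<Rightarrow> real^'p \<Rightarrow> real^'p^2^'p" where
  "A4 G H x \<mu> \<nu> = (\<chi> i.
     outer (column 3 (Dphi (G x $ i) (H x $ i) (\<mu> $ i) (\<nu> $ i))) (axis i 1))"

definition A5 :: "(real^'n \<Rightarrow> real^'p) \<Rightarrow> (real^'n \<Rightarrow> real^'p) \<Rightarrow>
    real^'n \<Rightarrow> real^'p \<Rightarrow> real^'p \<Rightarrow> real^'p^2^'p" where
  "A5 G H x \<mu> \<nu> = (\<chi> i.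
     outer (column 4 (Dphi (G x $ i) (H x $ i) (\<mu> $ i) (\<nu> $ i))) (axis i 1))"

text \<open>The block matrix \<open>DF(z)\<close> is represented by the linear map given by block-wise
  multiplication; invertibility of the matrix is bijectivity of this map.\<close>

fun newton_DF ::
  "(real^'n \<Rightarrow> real) \<Rightarrow> (real^'n \<Rightarrow> real^'l) \<Rightarrow> (real^'n \<Rightarrow> real^'m) \<Rightarrow>
    (real^'n \<Rightarrow> real^'p) \<Rightarrow> (real^'n \<Rightarrow> real^'p) \<Rightarrow>
    ('n, 'l, 'm, 'p) primal_dual \<Rightarrow>
    ('n, 'l, 'm, 'p) primal_dual \<Rightarrow> ('n, 'l, 'm, 'p) residual" where
  "newton_DF f g h G H (x, lam, \<eta>, \<mu>, \<nu>) (dx, dlam, d\<eta>, d\<mu>, d\<nu>) =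
    (hess (Lagr f g h G H lam \<eta> \<mu> \<nu>) x *v dx
       + transpose (jacobian g (at x)) *v dlam + transpose (jacobian h (at x)) *v d\<eta>
       + transpose (jacobian G (at x)) *v d\<mu> + transpose (jacobian H (at x)) *v d\<nu>,
     A1 g x lam *v dx + A2 g x lam *v dlam,
     jacobian h (at x) *v dx,
     stacked_mv (A3 G H x \<mu> \<nu>) dx + stacked_mv (A4 G H x \<mu> \<nu>) d\<mu>
       + stacked_mv (A5 G H x \<mu> \<nu>) d\<nu>)"

text \<open>The iterates are meaningful as long as \<^const>\<open>newton_DF\<close> is bijective at all of them.\<close>

primrec newton_seq ::
  "(real^'n \<Rightarrow> real) \<Rightarrow> (real^'n \<Rightarrow> real^'l) \<Rightarrow> (real^'n \<Rightarrow> real^'m) \<Rightarrow>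
    (real^'n \<Rightarrow> real^'p) \<Rightarrow> (real^'n \<Rightarrow> real^'p) \<Rightarrow>
    ('n, 'l, 'm, 'p) primal_dual \<Rightarrow> nat \<Rightarrow> ('n, 'l, 'm, 'p) primal_dual" where
  "newton_seq f g h G H z0 0 = z0"
| "newton_seq f g h G H z0 (Suc k) =
     newton_seq f g h G H z0 k
       - inv (newton_DF f g h G H (newton_seq f g h G H z0 k))
           (newton_F f g h G H (newton_seq f g h G H z0 k))"

definition newton_well_defined ::
  "(real^'n \<Rightarrow> real) \<Rightarrow> (real^'n \<Rightarrow> real^'l) \<Rightarrow> (real^'n \<Rightarrow> real^'m) \<Rightarrow>
    (real^'n \<Rightarrow> real^'p) \<Rightarrow> (real^'n \<Rightarrow> real^'p) \<Rightarrow>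
    ('n, 'l, 'm, 'p) primal_dual \<Rightarrow> bool" where
  "newton_well_defined f g h G H z0 \<longleftrightarrow>
     (\<forall>k. bij (newton_DF f g h G H (newton_seq f g h G H z0 k)))"

definition superlinear_conv :: "(nat \<Rightarrow> 'a::real_normed_vector) \<Rightarrow> 'a \<Rightarrow> bool" where
  "superlinear_conv z zbar \<longleftrightarrow>
     z \<longlonglongrightarrow> zbar \<and> (\<lambda>k. norm (z (Suc k) - zbar)) \<in> o(\<lambda>k. norm (z k - zbar))"

definition quadratic_conv :: "(nat \<Rightarrow> 'a::real_normed_vector) \<Rightarrow> 'a \<Rightarrow> bool" where
  "quadratic_conv z zbar \<longleftrightarrow>
     z \<longlonglongrightarrow> zbar \<and> (\<lambda>k. norm (z (Suc k) - zbar)) \<in> O(\<lambda>k. (norm (z k - zbar))\<^sup>2)"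

end

theory Submission
  imports Defs
begin

text \<open>A nonsmooth Newton method \<open>z\<^sub>k\<^sub>+\<^sub>1 = z\<^sub>k - DF(z\<^sub>k)\<^sup>-\<^sup>1 F(z\<^sub>k)\<close> converges superlinearly near \<open>zb\<close> as soon as
  the inverses of \<open>DF(z)\<close> are uniformly bounded near \<open>zb\<close> and \<open>F z - DF z (z - zb)\<close> is of smaller
  order than \<open>z - zb\<close>; it converges quadratically if this residual is quadratic
  (\<open>nonsmooth_newton_local_convergence\<close>).

  Both conditions rest on one property of \<^const>\<open>phi\<close>. The rows of \<^const>\<open>Dphi\<close> are signed unit vectors which
  select two of the coordinates \<open>(a, b, \<mu>, \<nu>)\<close>, always one of the pairs \<open>(a, b)\<close>, \<open>(a, \<nu>)\<close>, \<open>(b, \<mu>)\<close>, and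
  the selected coordinates are bounded by the continuous function \<^const>\<open>phi1\<close>, which vanishes on the
  M-complementarity set (\<open>Dphi_selects\<close>). So near an M-stationary point only coordinates
  that are zero in the solution can be selected (\<open>eventually_Dphi_active_pair\<close>). The function
  \<^const>\<open>pi_min\<close> has the same property (\<open>eventually_pi_min_branch\<close>).

  Residual: since \<^const>\<open>phi\<close> is piecewise linear with \<open>phi = Dphi *v w\<close> at every point \<open>w\<close>, and the
  selected coordinates vanish in the solution, the complementarity rows of the residual reduce to Taylor
  remainders of \<open>G\<close> and \<open>H\<close>. The remainders of the constraints are always quadratic; those of the
  gradients are of smaller order, and quadratic for locally Lipschitz Hessians (\<open>newton_residual_bigo\<close>).

  Bounded inverses: by compactness it suffices that a limit \<open>(dx, dlam, d\<eta>, d\<mu>, d\<nu>)\<close> of directions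
  that the Newton matrices nearly annihilate is zero. In the limit, for each complementarity index one
  of the three pairs has zero coordinates in the solution and in the direction. This puts \<open>dx\<close> into the
  set of critical directions and makes the products of multiplier and constraint directions vanish, so
  that the first row yields \<open>dx = 0\<close> by MPCC-SSOC and the rest by MPCC-LICQ
  (\<open>kernel_trivial\<close>, \<open>newton_DF_limits_injective\<close>).\<close>

section \<open>The coordinates selected by the Newton derivative of phi\<close>

definition vec4 :: "real \<Rightarrow> real \<Rightarrow> real \<Rightarrow> real \<Rightarrow> real^4" where
  "vec4 a b \<mu> \<nu> = (\<chi> k. if k = 1 then a else if k = 2 then b else if k = 3 then \<mu> else \<nu>)"

lemma vec4_nth [simp]:
  "vec4 a b \<mu> \<nu> $ 1 = a" "vec4 a b \<mu> \<nu> $ 2 = b" "vec4 a b \<mu> \<nu> $ 3 = \<mu>" "vec4 a b \<mu> \<nu> $ 4 = \<nu>"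
  by (simp_all add: vec4_def)

lemma unit4_neq: "unit4 j \<noteq> - unit4 k"
proof
  assume "unit4 j = - unit4 k"
  then have "unit4 j $ j = - unit4 k $ j" by simp
  then show False by (auto simp: unit4_def axis_def split: if_splits)
qed

lemma unit4_eq_iff: "unit4 j = unit4 k \<longleftrightarrow> j = k"
  by (simp add: unit4_def axis_eq_axis)

lemma abs_sig [simp]: "\<bar>sig s\<bar> = 1"
  by (simp add: sig_def)

lemma sig_mult_self [simp]: "sig s * s = \<bar>s\<bar>"
  by (simp add: sig_def)

text \<open>Indices \<open>1, 2, 3, 4\<close> stand for \<open>a, b, \<mu>, \<nu>\<close>. The sets where all coordinates of a pair vanish
  carry the three pieces of the M-complementarity set, the zero sets of \<^const>\<open>psi3\<close>, \<^const>\<open>psi2\<close> and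
  \<^const>\<open>psi1\<close> in this order; only the sign conditions are dropped.\<close>

definition selectable :: "4 set set" where
  "selectable = {{1, 2}, {1, 4}, {2, 3}}"

lemma psi_nonneg: "0 \<le> psi1 a b \<mu> \<nu>" "0 \<le> psi2 a b \<mu> \<nu>" "0 \<le> psi3 a b \<mu> \<nu>"
  by (simp_all add: psi1_def psi2_def psi3_def le_max_iff_disj)

text \<open>The argument that attains a maximum dominates its competitors. Hence in every case some coordinate
  that is a candidate for the second row of \<^const>\<open>Dphi\<close> is bounded by \<^const>\<open>phi1\<close>, which is the last
  condition of the case.\<close>

lemma phi1_cases:
  obtains (e1) s where "\<bar>s\<bar> = 1" "Dphi1 a b \<mu> \<nu> = s *\<^sub>R unit4 1"
      "phi1 a b \<mu> \<nu> = s * a" "\<bar>b\<bar> \<le> phi1 a b \<mu> \<nu> \<or> \<bar>\<nu>\<bar> \<le> phi1 a b \<mu> \<nu>"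
  | (e2) s where "\<bar>s\<bar> = 1" "Dphi1 a b \<mu> \<nu> = s *\<^sub>R unit4 2"
      "phi1 a b \<mu> \<nu> = s * b" "\<bar>a\<bar> \<le> phi1 a b \<mu> \<nu> \<or> \<bar>\<mu>\<bar> \<le> phi1 a b \<mu> \<nu>"
  | (e3) s where "\<bar>s\<bar> = 1" "Dphi1 a b \<mu> \<nu> = s *\<^sub>R unit4 3"
      "phi1 a b \<mu> \<nu> = s * \<mu>" "\<bar>b\<bar> \<le> phi1 a b \<mu> \<nu>"
  | (e4) s where "\<bar>s\<bar> = 1" "Dphi1 a b \<mu> \<nu> = s *\<^sub>R unit4 4"
      "phi1 a b \<mu> \<nu> = s * \<nu>" "\<bar>a\<bar> \<le> phi1 a b \<mu> \<nu>"
proof -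
  define m where "m = phi1 a b \<mu> \<nu>"
  note D = Dphi1_def[of a b \<mu> \<nu>, folded m_def] and e = e1[folded m_def] e2[folded m_def]
    e3[folded m_def] e4[folded m_def]
  consider (1) "psi1 a b \<mu> \<nu> = m" | (2) "psi1 a b \<mu> \<nu> \<noteq> m" "psi2 a b \<mu> \<nu> = m"
    | (3) "psi1 a b \<mu> \<nu> \<noteq> m" "psi2 a b \<mu> \<nu> \<noteq> m" "psi3 a b \<mu> \<nu> = m"
    unfolding m_def phi1_def by linarith
  then show thesis
  proof cases
    case 1
    have le: "\<bar>b\<bar> \<le> m" "\<bar>\<mu>\<bar> \<le> m"
      using 1 unfolding psi1_def by linarith+
    consider "- a = m" | "- a \<noteq> m" "\<bar>b\<bar> = m" | "- a \<noteq> m" "\<bar>b\<bar> \<noteq> m" "\<bar>\<mu>\<bar> = m"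
      using 1 unfolding psi1_def by linarith
    then show thesis
    proof cases
      case 1
      with D \<open>psi1 a b \<mu> \<nu> = m\<close> le show thesis by (intro e(1)[of "- 1"]) auto
    next
      case 2
      with D \<open>psi1 a b \<mu> \<nu> = m\<close> le show thesis by (intro e(2)[of "sig b"]) auto
    next
      case 3
      with D \<open>psi1 a b \<mu> \<nu> = m\<close> le show thesis by (intro e(3)[of "sig \<mu>"]) auto
    qed
  next
    case 2
    note neq = \<open>psi1 a b \<mu> \<nu> \<noteq> m\<close> \<open>psi2 a b \<mu> \<nu> = m\<close>
    have le: "\<bar>a\<bar> \<le> m" "\<bar>\<nu>\<bar> \<le> m"
      using neq unfolding psi2_def by linarith+
    consider "- b = m" | "- b \<noteq> m" "\<bar>a\<bar> = m" | "- b \<noteq> m" "\<bar>a\<bar> \<noteq> m" "\<bar>\<nu>\<bar> = m"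
      using neq unfolding psi2_def by linarith
    then show thesis
    proof cases
      case 1
      with D neq le show thesis by (intro e(2)[of "- 1"]) auto
    next
      case 2
      with D neq le show thesis by (intro e(1)[of "sig a"]) auto
    next
      case 3
      with D neq le show thesis by (intro e(4)[of "sig \<nu>"]) auto
    qed
  next
    case 3
    note neq = \<open>psi1 a b \<mu> \<nu> \<noteq> m\<close> \<open>psi2 a b \<mu> \<nu> \<noteq> m\<close> \<open>psi3 a b \<mu> \<nu> = m\<close>
    have le: "\<bar>a\<bar> \<le> m" "\<bar>b\<bar> \<le> m"
      using neq(3) unfolding psi3_def by linarith+
    consider "\<bar>a\<bar> = m" | "\<bar>a\<bar> \<noteq> m" "\<bar>b\<bar> = m" | "\<bar>a\<bar> \<noteq> m" "\<bar>b\<bar> \<noteq> m" "\<mu> = m"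
      | "\<bar>a\<bar> \<noteq> m" "\<bar>b\<bar> \<noteq> m" "\<mu> \<noteq> m" "\<nu> = m"
      using neq(3) unfolding psi3_def by linarith
    then show thesis
    proof cases
      case 1
      with D neq le show thesis by (intro e(1)[of "sig a"]) auto
    next
      case 2
      with D neq le show thesis by (intro e(2)[of "sig b"]) auto
    next
      case 3
      with D neq le show thesis by (intro e(3)[of 1]) auto
    next
      case 4
      with D neq le show thesis by (intro e(4)[of 1]) auto
    qed
  qed
qed

text \<open>The second row selects the smaller of its candidates, and one of them is bounded by \<^const>\<open>phi1\<close>;
  so both selected coordinates are. This is the decisive property of \<^const>\<open>phi\<close>: although
  \<^const>\<open>phi2\<close> jumps where the selection of \<^const>\<open>phi1\<close> changes, smallness of the continuous function
  \<^const>\<open>phi1\<close> forces both selected coordinates to be small.\<close>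

lemma Dphi_selects:
  obtains j k s t where "{j, k} \<in> selectable" "\<bar>s\<bar> = 1" "\<bar>t\<bar> = 1"
    "Dphi1 a b \<mu> \<nu> = s *\<^sub>R unit4 j" "Dphi2 a b \<mu> \<nu> = t *\<^sub>R unit4 k"
    "phi1 a b \<mu> \<nu> = s * vec4 a b \<mu> \<nu> $ j" "phi2 a b \<mu> \<nu> = t * vec4 a b \<mu> \<nu> $ k"
    "\<bar>vec4 a b \<mu> \<nu> $ j\<bar> \<le> phi1 a b \<mu> \<nu>" "\<bar>vec4 a b \<mu> \<nu> $ k\<bar> \<le> phi1 a b \<mu> \<nu>"
proof -
  have nonneg: "0 \<le> phi1 a b \<mu> \<nu>"
    by (simp add: phi1_def psi_nonneg)
  have sgn: "s = 1 \<or> s = - 1" if "\<bar>s\<bar> = 1" for s :: real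
    using that by linarith
  note [simp] = unit4_eq_iff unit4_neq unit4_neq[symmetric]
  show thesis
  proof (cases a b \<mu> \<nu> rule: phi1_cases)
    case (e1 s)
    have D: "Dphi1 a b \<mu> \<nu> \<in> {unit4 1, - unit4 1}"
      using e1 sgn[of s] by auto
    have *: "\<bar>a\<bar> \<le> phi1 a b \<mu> \<nu>"
      using nonneg e1 sgn[of s] by auto
    show thesis
    proof (cases "\<bar>b\<bar> \<le> \<bar>\<nu>\<bar>")
      case True
      then show thesis
        using that[of 1 2 s "sig b"] e1 D * by (auto simp: selectable_def phi2_def Dphi2_def doubleton_eq_iff)
    next
      case False
      then show thesis
        using that[of 1 4 s "sig \<nu>"] e1 D * by (auto simp: selectable_def phi2_def Dphi2_def doubleton_eq_iff)
    qed
  next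
    case (e2 s)
    have D: "Dphi1 a b \<mu> \<nu> \<in> {unit4 2, - unit4 2}" "Dphi1 a b \<mu> \<nu> \<notin> {unit4 1, - unit4 1}"
      using e2 sgn[of s] by auto
    have *: "\<bar>b\<bar> \<le> phi1 a b \<mu> \<nu>"
      using nonneg e2 sgn[of s] by auto
    show thesis
    proof (cases "\<bar>a\<bar> \<le> \<bar>\<mu>\<bar>")
      case True
      then show thesis
        using that[of 2 1 s "sig a"] e2 D * by (auto simp: selectable_def phi2_def Dphi2_def doubleton_eq_iff)
    next
      case False
      then show thesis
        using that[of 2 3 s "sig \<mu>"] e2 D * by (auto simp: selectable_def phi2_def Dphi2_def doubleton_eq_iff)
    qed
  next
    case (e3 s)
    have D: "Dphi1 a b \<mu> \<nu> \<in> {unit4 3, - unit4 3}" "Dphi1 a b \<mu> \<nu> \<notin> {unit4 1, - unit4 1}"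
      "Dphi1 a b \<mu> \<nu> \<notin> {unit4 2, - unit4 2}"
      using e3 sgn[of s] by auto
    have *: "\<bar>\<mu>\<bar> \<le> phi1 a b \<mu> \<nu>"
      using nonneg e3 sgn[of s] by auto
    show thesis
      using that[of 3 2 s "sig b"] e3 D * by (auto simp: selectable_def phi2_def Dphi2_def doubleton_eq_iff)
  next
    case (e4 s)
    have D: "Dphi1 a b \<mu> \<nu> \<notin> {unit4 3, - unit4 3}" "Dphi1 a b \<mu> \<nu> \<notin> {unit4 1, - unit4 1}"
      "Dphi1 a b \<mu> \<nu> \<notin> {unit4 2, - unit4 2}"
      using e4 sgn[of s] by auto
    have *: "\<bar>\<nu>\<bar> \<le> phi1 a b \<mu> \<nu>"
      using nonneg e4 sgn[of s] by auto
    show thesis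
      using that[of 4 1 s "sig a"] e4 D * by (auto simp: selectable_def phi2_def Dphi2_def doubleton_eq_iff)
  qed
qed

lemma Dphi_mult_nth:
  "(Dphi a b \<mu> \<nu> *v t) $ 1 = Dphi1 a b \<mu> \<nu> \<bullet> t" "(Dphi a b \<mu> \<nu> *v t) $ 2 = Dphi2 a b \<mu> \<nu> \<bullet> t"
  by (simp_all add: matrix_vector_mul_component Dphi_def)

lemma unit4_inner: "unit4 j \<bullet> t = t $ j"
  by (simp add: unit4_def inner_axis')

text \<open>Both components of \<^const>\<open>phi\<close> are piecewise linear without constant terms, and
  \<^const>\<open>Dphi\<close> takes its rows from the linear pieces that are active at the point itself.\<close>

lemma phi_eq_Dphi_mult: "phi a b \<mu> \<nu> = Dphi a b \<mu> \<nu> *v vec4 a b \<mu> \<nu>"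
proof -
  obtain j k s r where "Dphi1 a b \<mu> \<nu> = s *\<^sub>R unit4 j" "Dphi2 a b \<mu> \<nu> = r *\<^sub>R unit4 k"
    "phi1 a b \<mu> \<nu> = s * vec4 a b \<mu> \<nu> $ j" "phi2 a b \<mu> \<nu> = r * vec4 a b \<mu> \<nu> $ k"
    by (rule Dphi_selects)
  then have "phi a b \<mu> \<nu> $ 1 = (Dphi a b \<mu> \<nu> *v vec4 a b \<mu> \<nu>) $ 1"
    "phi a b \<mu> \<nu> $ 2 = (Dphi a b \<mu> \<nu> *v vec4 a b \<mu> \<nu>) $ 2"
    by (simp_all add: phi_def Dphi_mult_nth unit4_inner)
  then show ?thesis
    by (simp only: vec_eq_iff forall_2)
qed

text \<open>Signs and order of the two rows do not affect kernels or norms, so that only the set of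
  selected coordinates is recorded.\<close>

lemma Dphi_active_pair:
  obtains P where "P \<in> selectable" "\<And>j. j \<in> P \<Longrightarrow> \<bar>vec4 a b \<mu> \<nu> $ j\<bar> \<le> phi1 a b \<mu> \<nu>"
    "\<And>t j. j \<in> P \<Longrightarrow> \<bar>t $ j\<bar> \<le> norm (Dphi a b \<mu> \<nu> *v t)"
    "\<And>t. norm (Dphi a b \<mu> \<nu> *v t) \<le> (\<Sum>j\<in>P. \<bar>t $ j\<bar>)"
proof -
  obtain j k s r where jk: "{j, k} \<in> selectable" "\<bar>s\<bar> = 1" "\<bar>r\<bar> = 1"
    "Dphi1 a b \<mu> \<nu> = s *\<^sub>R unit4 j" "Dphi2 a b \<mu> \<nu> = r *\<^sub>R unit4 k"
    "phi1 a b \<mu> \<nu> = s * vec4 a b \<mu> \<nu> $ j" "phi2 a b \<mu> \<nu> = r * vec4 a b \<mu> \<nu> $ k"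
    "\<bar>vec4 a b \<mu> \<nu> $ j\<bar> \<le> phi1 a b \<mu> \<nu>" "\<bar>vec4 a b \<mu> \<nu> $ k\<bar> \<le> phi1 a b \<mu> \<nu>"
    by (rule Dphi_selects)
  have "j \<noteq> k"
    using jk(1) by (auto simp: selectable_def doubleton_eq_iff)
  have nth: "(Dphi a b \<mu> \<nu> *v t) $ 1 = s * t $ j" "(Dphi a b \<mu> \<nu> *v t) $ 2 = r * t $ k" for t
    by (simp_all add: Dphi_mult_nth jk unit4_inner)
  show thesis
  proof
    show "{j, k} \<in> selectable" by fact
    show "\<bar>vec4 a b \<mu> \<nu> $ i\<bar> \<le> phi1 a b \<mu> \<nu>" if "i \<in> {j, k}" for i
      using that jk by auto
    show "\<bar>t $ i\<bar> \<le> norm (Dphi a b \<mu> \<nu> *v t)" if "i \<in> {j, k}" for t i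
      using that component_le_norm_cart[of "Dphi a b \<mu> \<nu> *v t" 1]
        component_le_norm_cart[of "Dphi a b \<mu> \<nu> *v t" 2] jk
      by (auto simp: nth abs_mult)
    show "norm (Dphi a b \<mu> \<nu> *v t) \<le> (\<Sum>i\<in>{j, k}. \<bar>t $ i\<bar>)" for t
      using norm_le_l1_cart[of "Dphi a b \<mu> \<nu> *v t"] jk \<open>j \<noteq> k\<close>
      by (auto simp: nth abs_mult sum_2)
  qed
qed

lemma continuous_phi1:
  assumes "(a \<longlongrightarrow> a') F" "(b \<longlongrightarrow> b') F" "(\<mu> \<longlongrightarrow> \<mu>') F" "(\<nu> \<longlongrightarrow> \<nu>') F"
  shows "((\<lambda>z. phi1 (a z) (b z) (\<mu> z) (\<nu> z)) \<longlongrightarrow> phi1 a' b' \<mu>' \<nu>') F"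
  unfolding phi1_def psi1_def psi2_def psi3_def by (intro tendsto_intros assms)

lemma phi1_eq_0_if_M_complementary:
  assumes "a \<ge> 0" "b \<ge> 0" "a * b = 0" "a > 0 \<Longrightarrow> \<mu> = 0" "b > 0 \<Longrightarrow> \<nu> = 0"
    "a = 0 \<Longrightarrow> b = 0 \<Longrightarrow> \<mu> * \<nu> = 0 \<or> \<mu> < 0 \<and> \<nu> < 0"
  shows "phi1 a b \<mu> \<nu> = 0"
proof -
  consider "a > 0" "b = 0" "\<mu> = 0" | "b > 0" "a = 0" "\<nu> = 0" | "a = 0" "b = 0"
    using assms(1-5) by (cases "a = 0"; cases "b = 0") auto
  then have "psi1 a b \<mu> \<nu> = 0 \<or> psi2 a b \<mu> \<nu> = 0 \<or> psi3 a b \<mu> \<nu> = 0"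
  proof cases
    case 3
    then consider "\<mu> = 0" | "\<nu> = 0" | "\<mu> < 0" "\<nu> < 0"
      using assms(6) by auto
    then show ?thesis
      using 3 by cases (simp_all add: psi1_def psi2_def psi3_def)
  qed (simp_all add: psi1_def psi2_def)
  then show ?thesis
    using psi_nonneg[of a b \<mu> \<nu>] unfolding phi1_def by linarith
qed

text \<open>A coordinate that does not vanish in the limit eventually exceeds \<^const>\<open>phi1\<close>, which tends to zero;
  it can then no longer be selected.\<close>

lemma eventually_Dphi_active_pair:
  assumes lim: "(a \<longlongrightarrow> a') F" "(b \<longlongrightarrow> b') F" "(\<mu> \<longlongrightarrow> \<mu>') F" "(\<nu> \<longlongrightarrow> \<nu>') F"
    and zero: "phi1 a' b' \<mu>' \<nu>' = 0"
  shows "\<forall>\<^sub>F z in F. \<exists>P\<in>selectable. (\<forall>j\<in>P. vec4 a' b' \<mu>' \<nu>' $ j = 0) \<and>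
      (\<forall>t. \<forall>j\<in>P. \<bar>t $ j\<bar> \<le> norm (Dphi (a z) (b z) (\<mu> z) (\<nu> z) *v t)) \<and>
      (\<forall>t. norm (Dphi (a z) (b z) (\<mu> z) (\<nu> z) *v t) \<le> (\<Sum>j\<in>P. \<bar>t $ j\<bar>))"
proof -
  let ?w = "vec4 a' b' \<mu>' \<nu>'" and ?q = "\<lambda>z. vec4 (a z) (b z) (\<mu> z) (\<nu> z)"
    and ?m = "\<lambda>z. phi1 (a z) (b z) (\<mu> z) (\<nu> z)"
  have "\<forall>\<^sub>F z in F. ?w $ j \<noteq> 0 \<longrightarrow> ?m z < \<bar>?q z $ j\<bar>" for j
  proof (cases "?w $ j = 0")
    case False
    have q: "((\<lambda>z. \<bar>?q z $ j\<bar>) \<longlongrightarrow> \<bar>?w $ j\<bar>) F"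
      using exhaust_4[of j] lim by (auto intro: tendsto_rabs)
    have "((\<lambda>z. \<bar>?q z $ j\<bar> - ?m z) \<longlongrightarrow> \<bar>?w $ j\<bar> - 0) F"
      using continuous_phi1[OF lim] unfolding zero by (intro tendsto_diff q)
    then have "\<forall>\<^sub>F z in F. 0 < \<bar>?q z $ j\<bar> - ?m z"
      by (rule order_tendstoD) (use False in simp)
    then show ?thesis by eventually_elim simp
  qed simp
  then have "\<forall>\<^sub>F z in F. \<forall>j. ?w $ j \<noteq> 0 \<longrightarrow> ?m z < \<bar>?q z $ j\<bar>"
    by (intro eventually_all_finite)
  then show ?thesis
  proof eventually_elim
    case (elim z)
    show ?case
      by (rule Dphi_active_pair[of "a z" "b z" "\<mu> z" "\<nu> z"], use elim in \<open>meson not_le\<close>)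
  qed
qed

text \<open>Here \<open>(a, b, \<mu>, \<nu>)\<close> is the reference point and \<open>(\<alpha>, \<beta>, \<kappa>, \<rho>)\<close> a direction in the kernel of the
  selected rows. The products remove the complementarity terms from the quadratic form of the Newton
  system. The conditional equations, together with \<open>\<alpha> * \<beta> = 0\<close>, say that the direction is critical and that
  multipliers of inactive constraints do not move.\<close>

lemma selectable_coordinates:
  assumes "P \<in> selectable" "\<forall>j\<in>P. vec4 a b \<mu> \<nu> $ j = 0" "\<forall>j\<in>P. vec4 \<alpha> \<beta> \<kappa> \<rho> $ j = 0"
  shows "\<alpha> * \<beta> = 0" "\<alpha> * \<kappa> = 0" "\<beta> * \<rho> = 0"
    "\<mu> \<noteq> 0 \<or> b \<noteq> 0 \<Longrightarrow> \<alpha> = 0" "\<nu> \<noteq> 0 \<or> a \<noteq> 0 \<Longrightarrow> \<beta> = 0" "b \<noteq> 0 \<Longrightarrow> \<rho> = 0" "a \<noteq> 0 \<Longrightarrow> \<kappa> = 0"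
  using assms by (auto simp: selectable_def)

section \<open>Taylor remainders with derivatives at the variable point\<close>

lemma norm_matrix_vector_mult_le:
  fixes A :: "real^'n^'m"
  shows "norm (A *v x) \<le> norm A * norm x"
proof -
  have "norm (A *v x) \<le> L2_set (\<lambda>i. norm (A $ i) * norm x) UNIV"
    unfolding norm_vec_def[of "A *v x"]
    by (rule L2_set_mono) (simp_all add: matrix_vector_mul_component Cauchy_Schwarz_ineq2)
  also have "\<dots> = norm A * norm x"
    by (simp add: norm_vec_def[of A] L2_set_left_distrib)
  finally show ?thesis .
qed

lemma bounded_bilinear_matrix_vector_mult:
  "bounded_bilinear ((*v) :: real^'n^'m \<Rightarrow> real^'n \<Rightarrow> real^'m)"
proof
  show "\<exists>K. \<forall>(A :: real^'n^'m) x. norm (A *v x) \<le> norm A * norm x * K"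
    by (intro exI[of _ 1]) (simp add: norm_matrix_vector_mult_le)
qed (simp_all add: algebra_simps scaleR_matrix_vector_assoc matrix_vector_mult_scaleR)

lemma onorm_matrix_le_norm:
  fixes A :: "real^'n^'m"
  shows "onorm ((*v) A) \<le> norm A"
  by (rule onorm_le) (rule norm_matrix_vector_mult_le)

lemma grad_eq_if_GDERIV:
  assumes "GDERIV u x :> d"
  shows "grad u x = d"
proof -
  have "u differentiable (at x)"
    using assms by (auto simp: gderiv_def differentiable_def)
  then have "GDERIV u x :> grad u x"
    by (rule gderiv_grad)
  with assms have "(\<lambda>v. v \<bullet> d) = (\<lambda>v. v \<bullet> grad u x)"
    unfolding gderiv_def by (rule has_derivative_unique)
  then show ?thesis
    by (metis vector_eq_ldot)
qed

lemma hess_eq_if_has_derivative: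
  assumes "(grad u has_derivative (*v) A) (at x)"
  shows "hess u x = A"
proof -
  have "frechet_derivative (grad u) (at x) = (*v) A"
    using frechet_derivative_at[OF assms] by simp
  then show ?thesis
    by (simp add: hess_def jacobian_def matrix_of_matrix_vector_mul)
qed

lemma has_derivative_grad:
  assumes "twice_cont_diff u"
  shows "(grad u has_derivative (*v) (hess u x)) (at x)"
  using assms unfolding twice_cont_diff_def hess_def by (simp flip: jacobian_works)

lemma twice_cont_diff_GDERIV:
  assumes "twice_cont_diff u"
  shows "GDERIV u x :> grad u x"
  using assms by (intro gderiv_grad) (simp add: twice_cont_diff_def)

lemma isCont_grad: "twice_cont_diff u \<Longrightarrow> isCont (grad u) x"
  using has_derivative_continuous[OF has_derivative_grad] by blast

lemma isCont_hess: "twice_cont_diff u \<Longrightarrow> isCont (hess u) x"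
  unfolding twice_cont_diff_def by (simp add: continuous_on_eq_continuous_at)

lemma isCont_twice_cont_diff: "twice_cont_diff u \<Longrightarrow> isCont u x"
  using has_derivative_continuous twice_cont_diff_GDERIV unfolding gderiv_def by blast

text \<open>Taylor remainders about \<open>y\<close>, with the derivative taken at the variable point \<open>x\<close>: the Newton
  matrix is evaluated at the iterate and not at the solution.\<close>

definition grad_err :: "(real^'n \<Rightarrow> real) \<Rightarrow> real^'n \<Rightarrow> real^'n \<Rightarrow> real^'n" where
  "grad_err u y x = grad u x - grad u y - hess u x *v (x - y)"

definition val_err :: "(real^'n \<Rightarrow> real) \<Rightarrow> real^'n \<Rightarrow> real^'n \<Rightarrow> real" where
  "val_err u y x = u x - u y - grad u x \<bullet> (x - y)"

text \<open>The mean value inequality for \<open>grad u\<close> minus its linearization at \<open>x\<close>.\<close>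

lemma norm_grad_err_le:
  assumes u: "twice_cont_diff u"
    and B: "\<And>y. y \<in> closed_segment xb x \<Longrightarrow> norm (hess u y - hess u x) \<le> B"
  shows "norm (grad_err u xb x) \<le> B * norm (x - xb)"
proof -
  let ?f = "\<lambda>y. grad u y - hess u x *v y"
  have "norm (?f x - ?f xb) \<le> B * norm (x - xb)"
  proof (rule differentiable_bound[OF convex_closed_segment])
    fix y assume y: "y \<in> closed_segment xb x"
    show "(?f has_derivative (*v) (hess u y - hess u x)) (at y within closed_segment xb x)"
      unfolding matrix_vector_mult_diff_rdistrib
      by (intro has_derivative_diff has_derivative_at_withinI[OF has_derivative_grad[OF u]]
          bounded_linear_imp_has_derivative matrix_vector_mul_bounded_linear)
    show "onorm ((*v) (hess u y - hess u x)) \<le> B"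
      using onorm_matrix_le_norm B[OF y] by (rule order_trans)
  qed simp_all
  then show ?thesis
    by (simp add: grad_err_def algebra_simps)
qed

text \<open>Continuity of the Hessian makes its oscillation on the segment from \<open>xb\<close> to \<open>x\<close> small.\<close>

lemma grad_err_smallo:
  assumes u: "twice_cont_diff u"
  shows "(\<lambda>x. norm (grad_err u xb x)) \<in> o[nhds xb](\<lambda>x. norm (x - xb))"
proof (rule landau_o.smallI)
  fix c :: real assume "c > 0"
  then obtain r where "r > 0" and r: "\<And>y. dist y xb < r \<Longrightarrow> dist (hess u y) (hess u xb) < c / 2"
    using isCont_hess[OF u, of xb] unfolding continuous_at_eps_delta by (metis half_gt_zero)
  have "norm (grad_err u xb x) \<le> c * norm (x - xb)" if x: "dist x xb < r" for x
  proof (rule norm_grad_err_le[OF u])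
    fix y assume y: "y \<in> closed_segment xb x"
    have "dist y xb < r"
      using segment_bound(1)[OF y] x by (simp add: dist_norm norm_minus_commute)
    from r[OF this] r[OF x] have "dist (hess u y) (hess u x) < c"
      by (rule dist_triangle_half_l)
    then show "norm (hess u y - hess u x) \<le> c"
      by (simp add: dist_norm)
  qed
  moreover have "\<forall>\<^sub>F x in nhds xb. dist x xb < r"
    using \<open>r > 0\<close> by (auto simp: eventually_nhds_metric)
  ultimately show "\<forall>\<^sub>F x in nhds xb. norm (norm (grad_err u xb x)) \<le> c * norm (norm (x - xb))"
    by (auto elim: eventually_mono)
qed

lemma grad_err_bigo:
  assumes u: "twice_cont_diff u" and lip: "loc_lipschitz_hess u"
  shows "(\<lambda>x. norm (grad_err u xb x)) \<in> O[nhds xb](\<lambda>x. (norm (x - xb))\<^sup>2)"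
proof -
  obtain r C where "r > 0" and C: "C-lipschitz_on (cball xb r) (hess u)"
    using lip unfolding loc_lipschitz_hess_def by blast
  have "C \<ge> 0"
    using C by (rule lipschitz_on_nonneg)
  have "norm (grad_err u xb x) \<le> C * norm (x - xb) * norm (x - xb)" if x: "dist x xb < r" for x
  proof (rule norm_grad_err_le[OF u])
    fix y assume y: "y \<in> closed_segment xb x"
    have "y \<in> cball xb r" "x \<in> cball xb r"
      using segment_bound(1)[OF y] x by (simp_all add: dist_norm norm_minus_commute)
    then have "norm (hess u y - hess u x) \<le> C * norm (y - x)"
      by (rule lipschitz_on_normD[OF C])
    also have "\<dots> \<le> C * norm (x - xb)"
      using segment_bound(2)[OF y] \<open>C \<ge> 0\<close> by (intro mult_left_mono) (simp_all add: norm_minus_commute)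
    finally show "norm (hess u y - hess u x) \<le> C * norm (x - xb)" .
  qed
  moreover have "\<forall>\<^sub>F x in nhds xb. dist x xb < r"
    using \<open>r > 0\<close> by (auto simp: eventually_nhds_metric)
  ultimately have "\<forall>\<^sub>F x in nhds xb. norm (norm (grad_err u xb x)) \<le> C * norm ((norm (x - xb))\<^sup>2)"
    by (auto elim!: eventually_mono simp: power2_eq_square mult.assoc)
  then show ?thesis
    by (rule bigoI)
qed

text \<open>A continuous Hessian is locally bounded, so the gradient is locally Lipschitz and the remainder of the
  values is quadratic. Only the remainders of the gradients limit the rate of convergence.\<close>

lemma val_err_bigo:
  assumes u: "twice_cont_diff u"
  shows "(\<lambda>x. val_err u xb x) \<in> O[nhds xb](\<lambda>x. (norm (x - xb))\<^sup>2)"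
proof -
  define K where "K = norm (hess u xb) + 1"
  obtain r where "r > 0" and r: "\<And>y. dist y xb < r \<Longrightarrow> dist (hess u y) (hess u xb) < 1"
    using isCont_hess[OF u, of xb] unfolding continuous_at_eps_delta by (metis zero_less_one)
  have K: "norm (hess u y) \<le> K" if "dist y xb < r" for y
    using r[OF that] norm_triangle_ineq2[of "hess u y" "hess u xb"] by (simp add: K_def dist_norm)
  have "\<bar>val_err u xb x\<bar> \<le> K * norm (x - xb) * norm (x - xb)" if x: "dist x xb < r" for x
  proof -
    let ?S = "closed_segment xb x"
    have near: "dist y xb < r" if "y \<in> ?S" for y
      using segment_bound(1)[OF that] x by (simp add: dist_norm norm_minus_commute)
    have grad_le: "norm (grad u y - grad u x) \<le> K * norm (x - xb)" if y: "y \<in> ?S" for y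
    proof -
      have "norm (grad u y - grad u x) \<le> K * norm (y - x)"
        using y by (intro differentiable_bound[OF convex_closed_segment, of xb x _ "\<lambda>w. (*v) (hess u w)"]
            has_derivative_at_withinI[OF has_derivative_grad[OF u]]
            order_trans[OF onorm_matrix_le_norm K[OF near]]) simp_all
      also have "\<dots> \<le> K * norm (x - xb)"
        using segment_bound(2)[OF y]
        by (intro mult_left_mono) (simp_all add: norm_minus_commute K_def)
      finally show ?thesis .
    qed
    let ?f = "\<lambda>y. u y - y \<bullet> grad u x"
    have "norm (?f x - ?f xb) \<le> K * norm (x - xb) * norm (x - xb)"
    proof (rule differentiable_bound[OF convex_closed_segment])
      fix y assume y: "y \<in> ?S"
      show "(?f has_derivative (\<lambda>v. v \<bullet> grad u y - v \<bullet> grad u x)) (at y within ?S)"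
        using twice_cont_diff_GDERIV[OF u, of y] unfolding gderiv_def
        by (intro has_derivative_at_withinI[OF has_derivative_diff]
            bounded_linear_imp_has_derivative bounded_linear_inner_left)
      show "onorm (\<lambda>v. v \<bullet> grad u y - v \<bullet> grad u x) \<le> K * norm (x - xb)"
      proof (rule onorm_le)
        fix v
        have "\<bar>v \<bullet> (grad u y - grad u x)\<bar> \<le> norm v * norm (grad u y - grad u x)"
          by (rule Cauchy_Schwarz_ineq2)
        also have "\<dots> \<le> norm v * (K * norm (x - xb))"
          by (intro mult_left_mono grad_le y norm_ge_zero)
        finally show "norm (v \<bullet> grad u y - v \<bullet> grad u x) \<le> K * norm (x - xb) * norm v"
          by (simp add: inner_diff_right mult_ac)
      qed
    qed simp_all
    then show ?thesis
      by (simp add: val_err_def inner_diff_right inner_commute algebra_simps)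
  qed
  moreover have "\<forall>\<^sub>F x in nhds xb. dist x xb < r"
    using \<open>r > 0\<close> by (auto simp: eventually_nhds_metric)
  ultimately have "\<forall>\<^sub>F x in nhds xb. norm (val_err u xb x) \<le> K * norm ((norm (x - xb))\<^sup>2)"
    by (auto elim!: eventually_mono simp: power2_eq_square mult.assoc)
  then show ?thesis
    by (rule bigoI)
qed

section \<open>Weighted sums of component gradients and the Lagrangian\<close>

text \<open>Gradient and Hessian of \<open>\<lambda>x. c \<bullet> u x\<close>, written as sums to make the linear dependence on the
  weights and the joint continuity in \<open>c\<close> and \<open>x\<close> explicit.\<close>

definition wgrad :: "real^'k \<Rightarrow> (real^'n \<Rightarrow> real^'k) \<Rightarrow> real^'n \<Rightarrow> real^'n" where
  "wgrad c u x = (\<Sum>i\<in>UNIV. c $ i *\<^sub>R grad (\<lambda>y. u y $ i) x)"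

definition whess :: "real^'k \<Rightarrow> (real^'n \<Rightarrow> real^'k) \<Rightarrow> real^'n \<Rightarrow> real^'n^'n" where
  "whess c u x = (\<Sum>i\<in>UNIV. c $ i *\<^sub>R hess (\<lambda>y. u y $ i) x)"

lemma wgrad_diff: "wgrad (c - d) u x = wgrad c u x - wgrad d u x"
  by (simp add: wgrad_def scaleR_left_diff_distrib sum_subtractf)

lemma GDERIV_weighted_sum:
  assumes "twice_cont_diff_vec u"
  shows "GDERIV (\<lambda>x. c \<bullet> u x) x :> wgrad c u x"
proof -
  have "((\<lambda>x. \<Sum>i\<in>UNIV. c $ i * u x $ i) has_derivative
      (\<lambda>v. \<Sum>i\<in>UNIV. c $ i * (v \<bullet> grad (\<lambda>y. u y $ i) x))) (at x)"
    using assms twice_cont_diff_GDERIV unfolding twice_cont_diff_vec_def gderiv_def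
    by (intro has_derivative_sum has_derivative_mult_right) blast
  then show ?thesis
    by (simp add: gderiv_def wgrad_def inner_vec_def[of c] inner_sum_right)
qed

lemma has_derivative_wgrad:
  assumes "twice_cont_diff_vec u"
  shows "(wgrad c u has_derivative (*v) (whess c u x)) (at x)"
proof -
  have "((\<lambda>x. \<Sum>i\<in>UNIV. c $ i *\<^sub>R grad (\<lambda>y. u y $ i) x) has_derivative
      (\<lambda>v. \<Sum>i\<in>UNIV. c $ i *\<^sub>R (hess (\<lambda>y. u y $ i) x *v v))) (at x)"
    using assms has_derivative_grad unfolding twice_cont_diff_vec_def
    by (intro has_derivative_sum has_derivative_scaleR_right) blast
  moreover have "(\<Sum>i\<in>UNIV. c $ i *\<^sub>R (hess (\<lambda>y. u y $ i) x *v v)) = whess c u x *v v" for v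
    unfolding whess_def
    by (simp add: bounded_bilinear.sum_left[OF bounded_bilinear_matrix_vector_mult]
        scaleR_matrix_vector_assoc)
  ultimately show ?thesis
    by (simp add: wgrad_def[abs_def])
qed

lemma jacobian_row:
  assumes "twice_cont_diff_vec u"
  shows "jacobian u (at x) $ i = grad (\<lambda>y. u y $ i) x" "u differentiable (at x)"
proof -
  have comp: "((\<lambda>y. u y $ i) has_derivative (\<lambda>v. v \<bullet> grad (\<lambda>y. u y $ i) x)) (at x)" for i
    using assms twice_cont_diff_GDERIV unfolding twice_cont_diff_vec_def gderiv_def by blast
  have "(u has_derivative (\<lambda>v. \<chi> i. v \<bullet> grad (\<lambda>y. u y $ i) x)) (at x)"
    unfolding has_derivative_componentwise_within[of u]
    by (auto simp: Basis_vec_def inner_axis intro: comp)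
  then show "u differentiable (at x)"
    by (rule differentiableI)
  then have "(u has_derivative (*v) (jacobian u (at x))) (at x)"
    by (simp flip: jacobian_works)
  then have "((\<lambda>y. u y $ i) has_derivative (\<lambda>v. (jacobian u (at x) *v v) $ i)) (at x)"
    by (rule bounded_linear.has_derivative[OF bounded_linear_vec_nth])
  then have "GDERIV (\<lambda>y. u y $ i) x :> jacobian u (at x) $ i"
    by (simp add: gderiv_def matrix_vector_mul_component inner_commute)
  then show "jacobian u (at x) $ i = grad (\<lambda>y. u y $ i) x"
    by (metis grad_eq_if_GDERIV)
qed

lemma jacobian_mult_nth:
  "twice_cont_diff_vec u \<Longrightarrow> (jacobian u (at x) *v v) $ i = grad (\<lambda>y. u y $ i) x \<bullet> v"
  by (simp add: matrix_vector_mul_component jacobian_row)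

lemma transpose_jacobian_mult:
  "twice_cont_diff_vec u \<Longrightarrow> transpose (jacobian u (at x)) *v c = wgrad c u x"
  by (simp add: vec_eq_iff wgrad_def matrix_vector_mult_def transpose_def jacobian_row mult.commute)

lemma wgrad_inner: "wgrad c u x \<bullet> v = (\<Sum>i\<in>UNIV. c $ i * (grad (\<lambda>y. u y $ i) x \<bullet> v))"
  by (simp add: wgrad_def inner_sum_left)

lemma grad_Lagr:
  assumes "twice_cont_diff f" "twice_cont_diff_vec g" "twice_cont_diff_vec h"
    "twice_cont_diff_vec G" "twice_cont_diff_vec H"
  shows "grad (Lagr f g h G H lam \<eta> \<mu> \<nu>) x =
    grad f x + wgrad lam g x + wgrad \<eta> h x + wgrad \<mu> G x + wgrad \<nu> H x"
  unfolding Lagr_def[abs_def]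
  by (intro grad_eq_if_GDERIV GDERIV_add GDERIV_weighted_sum twice_cont_diff_GDERIV assms)

lemma hess_Lagr:
  assumes "twice_cont_diff f" "twice_cont_diff_vec g" "twice_cont_diff_vec h"
    "twice_cont_diff_vec G" "twice_cont_diff_vec H"
  shows "hess (Lagr f g h G H lam \<eta> \<mu> \<nu>) x =
    hess f x + whess lam g x + whess \<eta> h x + whess \<mu> G x + whess \<nu> H x"
proof (rule hess_eq_if_has_derivative)
  have "grad (Lagr f g h G H lam \<eta> \<mu> \<nu>) =
      (\<lambda>x. grad f x + wgrad lam g x + wgrad \<eta> h x + wgrad \<mu> G x + wgrad \<nu> H x)"
    by (intro ext grad_Lagr assms)
  then show "(grad (Lagr f g h G H lam \<eta> \<mu> \<nu>) has_derivative
      (*v) (hess f x + whess lam g x + whess \<eta> h x + whess \<mu> G x + whess \<nu> H x)) (at x)"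
    unfolding matrix_vector_mult_add_rdistrib
    by (auto intro!: has_derivative_add has_derivative_wgrad has_derivative_grad assms)
qed

section \<open>Convergence of an abstract nonsmooth Newton method\<close>

lemma linear_bij_if_bounded_below:
  fixes T :: "'a::euclidean_space \<Rightarrow> 'b::euclidean_space"
  assumes "linear T" "DIM('a) = DIM('b)" "c > 0" "\<And>v. c * norm v \<le> norm (T v)"
  shows "bij T"
proof -
  have inj: "inj T"
  proof (rule injI)
    fix v w assume "T v = T w"
    then have "c * norm (v - w) \<le> 0"
      using assms(4)[of "v - w"] by (simp add: linear_diff[OF \<open>linear T\<close>])
    then show "v = w"
      using \<open>c > 0\<close> by (simp add: mult_le_0_iff)
  qed
  have "dim (range T) = dim (UNIV :: 'a set)"
    using \<open>linear T\<close> inj by (intro dim_image_eq) auto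
  then have "span (range T) = UNIV"
    using assms(2) by (simp add: dim_eq_full[symmetric] dim_UNIV)
  then have "range T = UNIV"
    using span_linear_image[OF \<open>linear T\<close>, of UNIV] by simp
  with inj show ?thesis
    by (simp add: bij_def)
qed

text \<open>If no uniform bound existed, there would be unit vectors \<open>v\<^sub>k\<close> and points \<open>z\<^sub>k\<close> tending to \<open>zb\<close> with
  \<open>T z\<^sub>k v\<^sub>k\<close> tending to zero, and a convergent subsequence of the \<open>v\<^sub>k\<close> would contradict the hypothesis.
  The map \<open>T\<close> may be discontinuous in \<open>z\<close>.\<close>

lemma uniform_lower_bound_if_limits_injective:
  fixes T :: "'a::metric_space \<Rightarrow> 'b::euclidean_space \<Rightarrow> 'c::real_normed_vector"
  assumes lin: "\<And>z. linear (T z)"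
    and inj: "\<And>z v w. z \<longlonglongrightarrow> zb \<Longrightarrow> v \<longlonglongrightarrow> w \<Longrightarrow> (\<lambda>k. T (z k) (v k)) \<longlonglongrightarrow> 0 \<Longrightarrow> w = 0"
  shows "\<exists>c>0. \<forall>\<^sub>F z in nhds zb. \<forall>v. c * norm v \<le> norm (T z v)"
proof (rule ccontr)
  assume contra: "\<not> ?thesis"
  have "\<exists>z v. dist z zb < inverse (Suc k) \<and> norm v = 1 \<and> norm (T z v) < inverse (Suc k)" for k
  proof -
    have "0 < inverse (real (Suc k))" by simp
    with contra obtain z v where z: "dist z zb < inverse (Suc k)"
      and v: "norm (T z v) < inverse (Suc k) * norm v"
      unfolding eventually_nhds_metric by (meson not_le)
    have "v \<noteq> 0"
      using v by auto
    let ?v = "inverse (norm v) *\<^sub>R v"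
    have "norm (T z ?v) = inverse (norm v) * norm (T z v)"
      by (simp add: linear_cmul[OF lin])
    also have "\<dots> < inverse (norm v) * (inverse (Suc k) * norm v)"
      using v \<open>v \<noteq> 0\<close> by (intro mult_strict_left_mono) auto
    also have "\<dots> = inverse (Suc k)"
      using \<open>v \<noteq> 0\<close> by (simp del: of_nat_Suc)
    finally show ?thesis
      using z \<open>v \<noteq> 0\<close> by (intro exI[of _ z] exI[of _ ?v]) simp
  qed
  then obtain z v where zv: "\<And>k. dist (z k) zb < inverse (Suc k)" "\<And>k. norm (v k) = 1"
    "\<And>k. norm (T (z k) (v k)) < inverse (Suc k)"
    by metis
  have inv0: "(\<lambda>k. inverse (real (Suc k))) \<longlonglongrightarrow> 0"
    by (rule LIMSEQ_inverse_real_of_nat)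
  have z: "z \<longlonglongrightarrow> zb"
    by (rule metric_tendsto_imp_tendsto[OF inv0]) (use zv(1) in \<open>simp add: dist_real_def less_imp_le\<close>)
  have Tv: "(\<lambda>k. T (z k) (v k)) \<longlonglongrightarrow> 0"
    by (rule metric_tendsto_imp_tendsto[OF inv0]) (use zv(3) in \<open>simp add: dist_real_def less_imp_le\<close>)
  have "\<forall>k. v k \<in> sphere 0 1"
    by (simp add: zv)
  then obtain w r where w: "w \<in> sphere 0 1" and r: "strict_mono r" "(v \<circ> r) \<longlonglongrightarrow> w"
    using compact_sphere[of 0 1] unfolding compact_def by metis
  have "w = 0"
  proof (rule inj)
    show "(z \<circ> r) \<longlonglongrightarrow> zb"
      using z r(1) by (rule LIMSEQ_subseq_LIMSEQ)
    show "(\<lambda>k. T ((z \<circ> r) k) ((v \<circ> r) k)) \<longlonglongrightarrow> 0"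
      using LIMSEQ_subseq_LIMSEQ[OF Tv r(1)] by (simp add: o_def)
  qed (fact r(2))
  with w show False by simp
qed

text \<open>The error after a Newton step solves the linear system with matrix \<open>T z\<close> and right-hand side
  \<open>T z (z - zb) - F z\<close>. With inverses of norm at most \<open>1 / c\<close>, its norm is at most \<open>1 / c\<close> times the
  residual \<open>norm (F z - T z (z - zb))\<close>; the order of the residual therefore is the order of convergence.
  At \<open>zb\<close> itself the residual condition says that \<open>F zb = 0\<close>.\<close>

theorem nonsmooth_newton_local_convergence:
  fixes F :: "'a::euclidean_space \<Rightarrow> 'b::euclidean_space" and T :: "'a \<Rightarrow> 'a \<Rightarrow> 'b"
  assumes lin: "\<And>z. linear (T z)"
    and dims: "DIM('a) = DIM('b)"
    and lower: "c > 0" "\<forall>\<^sub>F z in nhds zb. \<forall>v. c * norm v \<le> norm (T z v)"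
    and small: "(\<lambda>z. norm (F z - T z (z - zb))) \<in> o[nhds zb](\<lambda>z. norm (z - zb))"
  shows "\<exists>\<delta>>0. \<forall>zs. zs 0 \<in> cball zb \<delta> \<longrightarrow> (\<forall>k. zs (Suc k) = zs k - inv (T (zs k)) (F (zs k))) \<longrightarrow>
    (\<forall>k. bij (T (zs k))) \<and> superlinear_conv zs zb \<and>
    ((\<lambda>z. norm (F z - T z (z - zb))) \<in> O[nhds zb](\<lambda>z. (norm (z - zb))\<^sup>2) \<longrightarrow> quadratic_conv zs zb)"
proof -
  let ?r = "\<lambda>z. norm (F z - T z (z - zb))"
  \<comment> \<open>The constant c / 2 makes every step halve the distance to zb.\<close>
  have "\<forall>\<^sub>F z in nhds zb. norm (?r z) \<le> c / 2 * norm (norm (z - zb))"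
    using small \<open>c > 0\<close> by (intro landau_o.smallD) simp_all
  with lower(2) have "\<forall>\<^sub>F z in nhds zb. (\<forall>v. c * norm v \<le> norm (T z v)) \<and> ?r z \<le> c / 2 * norm (z - zb)"
    by eventually_elim simp
  then obtain d where "d > 0" and d: "\<And>z. dist z zb < d \<Longrightarrow>
      (\<forall>v. c * norm v \<le> norm (T z v)) \<and> ?r z \<le> c / 2 * norm (z - zb)"
    unfolding eventually_nhds_metric by auto
  have bij: "bij (T z)" if "dist z zb < d" for z
    using linear_bij_if_bounded_below[OF lin dims \<open>c > 0\<close>] d[OF that] by blast
  have step: "c * norm (z - inv (T z) (F z) - zb) \<le> ?r z" if "dist z zb < d" for z
  proof -
    have "T z (z - inv (T z) (F z) - zb) = T z (z - zb) - F z"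
      using surj_f_inv_f[OF bij_is_surj[OF bij[OF that]], of "F z"]
      by (simp add: linear_diff[OF lin])
    moreover have "c * norm (z - inv (T z) (F z) - zb) \<le> norm (T z (z - inv (T z) (F z) - zb))"
      using d[OF that] by blast
    ultimately show ?thesis
      by (simp add: norm_minus_commute)
  qed
  have "(\<forall>k. bij (T (zs k))) \<and> superlinear_conv zs zb \<and>
      (?r \<in> O[nhds zb](\<lambda>z. (norm (z - zb))\<^sup>2) \<longrightarrow> quadratic_conv zs zb)"
    if z0: "zs 0 \<in> cball zb (d / 2)" and zs: "\<And>k. zs (Suc k) = zs k - inv (T (zs k)) (F (zs k))" for zs
  proof -
    have half: "norm (zs (Suc k) - zb) \<le> norm (zs k - zb) / 2" if "dist (zs k) zb < d" for k
    proof -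
      have "c * norm (zs (Suc k) - zb) \<le> c * (norm (zs k - zb) / 2)"
        using step[OF that] d[OF that] by (simp add: zs)
      then show ?thesis
        using \<open>c > 0\<close> by (simp only: mult_le_cancel_left_pos)
    qed
    have geo: "norm (zs k - zb) \<le> (1 / 2) ^ k * (d / 2)" for k
    proof (induction k)
      case 0
      then show ?case using z0 by (simp add: dist_norm norm_minus_commute)
    next
      case (Suc k)
      have "(1 / 2 :: real) ^ k * (d / 2) \<le> 1 * (d / 2)"
        using \<open>d > 0\<close> by (intro mult_right_mono power_le_one) simp_all
      then have "dist (zs k) zb < d"
        using Suc.IH \<open>d > 0\<close> unfolding dist_norm by linarith
      from half[OF this] Suc.IH show ?case by simp
    qed
    have near: "dist (zs k) zb < d" for k
    proof -
      have "(1 / 2 :: real) ^ k * (d / 2) \<le> 1 * (d / 2)"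
        using \<open>d > 0\<close> by (intro mult_right_mono power_le_one) simp_all
      then show ?thesis
        using geo[of k] \<open>d > 0\<close> unfolding dist_norm by linarith
    qed
    have lim: "zs \<longlonglongrightarrow> zb"
    proof (rule metric_tendsto_imp_tendsto)
      show "(\<lambda>k. (1 / 2) ^ k * (d / 2)) \<longlonglongrightarrow> 0"
        by (intro tendsto_mult_left_zero LIMSEQ_realpow_zero) simp_all
      show "\<forall>\<^sub>F k in sequentially. dist (zs k) zb \<le> dist ((1 / 2) ^ k * (d / 2)) 0"
        using geo \<open>d > 0\<close> by (simp add: dist_norm)
    qed
    have dom: "(\<lambda>k. norm (zs (Suc k) - zb)) \<in> O(\<lambda>k. ?r (zs k))"
    proof (rule bigoI)
      show "\<forall>\<^sub>F k in sequentially. norm (norm (zs (Suc k) - zb)) \<le> (1 / c) * norm (?r (zs k))"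
        using step[OF near] \<open>c > 0\<close> by (simp add: zs field_simps)
    qed
    have "(\<lambda>k. norm (zs (Suc k) - zb)) \<in> o(\<lambda>k. norm (zs k - zb))"
      by (rule landau_o.big_small_trans[OF dom landau_o.small.compose[OF small lim]])
    moreover have "(\<lambda>k. norm (zs (Suc k) - zb)) \<in> O(\<lambda>k. (norm (zs k - zb))\<^sup>2)"
      if "?r \<in> O[nhds zb](\<lambda>z. (norm (z - zb))\<^sup>2)"
      by (rule landau_o.big_trans[OF dom landau_o.big.compose[OF that lim]])
    ultimately show ?thesis
      using lim bij[OF near] unfolding superlinear_conv_def quadratic_conv_def by blast
  qed
  then show ?thesis
    using \<open>d > 0\<close> by (intro exI[of _ "d / 2"]) auto
qed

section \<open>Full row rank and limits of selections\<close>

text \<open>Full rank makes the rows distinct as well as independent, so that a combination indexed by \<open>I\<close> can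
  be read as a combination of the set of rows.\<close>

lemma full_row_rank_onD:
  fixes V :: "real^'n^'r"
  assumes rank: "full_row_rank_on I V" and comb: "(\<Sum>r\<in>I. c r *\<^sub>R V $ r) = 0" and "r \<in> I"
  shows "c r = 0"
proof -
  let ?B = "(\<lambda>r. row r V) ` I"
  have row: "row r V = V $ r" for r
    by (simp add: row_def)
  have dim: "dim ?B = card I"
    using rank by (simp add: full_row_rank_on_def)
  have "card ?B \<le> card I" "dim ?B \<le> card ?B"
    by (simp_all add: card_image_le dim_le_card span_superset)
  then have card: "card ?B = card I"
    using dim by linarith
  then have inj: "inj_on (\<lambda>r. row r V) I"
    by (simp add: eq_card_imp_inj_on)
  have ind: "independent ?B"
    using dim card by (intro card_le_dim_spanning[of ?B ?B]) (simp_all add: span_superset)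
  let ?u = "\<lambda>v. c (the_inv_into I (\<lambda>r. row r V) v)"
  have "(\<Sum>v\<in>?B. ?u v *\<^sub>R v) = (\<Sum>r\<in>I. c r *\<^sub>R V $ r)"
    using inj by (simp add: sum.reindex the_inv_into_f_f row)
  then have "?u (row r V) = 0"
    using independentD[OF ind, of ?B ?u "row r V"] comb \<open>r \<in> I\<close> by simp
  then show ?thesis
    by (simp add: the_inv_into_f_f[OF inj \<open>r \<in> I\<close>])
qed

lemma tendsto_matrix_vector_mult:
  fixes A :: "'a \<Rightarrow> real^'n^'m"
  assumes "(A \<longlongrightarrow> A') F" "(v \<longlongrightarrow> v') F"
  shows "((\<lambda>k. A k *v v k) \<longlongrightarrow> A' *v v') F"
  using bounded_bilinear.tendsto[OF bounded_bilinear_matrix_vector_mult assms] .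

lemma tendsto_grad_component:
  "twice_cont_diff_vec u \<Longrightarrow> (x \<longlongrightarrow> y) F \<Longrightarrow> ((\<lambda>k. grad (\<lambda>y. u y $ i) (x k)) \<longlongrightarrow> grad (\<lambda>y. u y $ i) y) F"
  unfolding twice_cont_diff_vec_def by (metis isCont_tendsto_compose isCont_grad)

lemma tendsto_component:
  "twice_cont_diff_vec u \<Longrightarrow> (x \<longlongrightarrow> y) F \<Longrightarrow> ((\<lambda>k. u (x k) $ i) \<longlongrightarrow> u y $ i) F"
  unfolding twice_cont_diff_vec_def by (rule isCont_tendsto_compose[OF isCont_twice_cont_diff]) auto

lemma tendsto_wgrad:
  assumes "twice_cont_diff_vec u" "(x \<longlongrightarrow> y) F" "(c \<longlongrightarrow> d) F"
  shows "((\<lambda>k. wgrad (c k) u (x k)) \<longlongrightarrow> wgrad d u y) F"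
  unfolding wgrad_def
  by (intro tendsto_sum tendsto_scaleR tendsto_vec_nth tendsto_grad_component assms)

lemma tendsto_whess:
  assumes "twice_cont_diff_vec u" "(x \<longlongrightarrow> y) F" "(c \<longlongrightarrow> d) F"
  shows "((\<lambda>k. whess (c k) u (x k)) \<longlongrightarrow> whess d u y) F"
  unfolding whess_def using assms(1) unfolding twice_cont_diff_vec_def
  by (intro tendsto_sum tendsto_scaleR tendsto_vec_nth assms isCont_tendsto_compose[OF isCont_hess])
    auto

text \<open>The minimum tends to zero, and the branch taken is the one that attains it. An argument
  with positive limit is therefore not taken near the limit.\<close>

lemma eventually_pi_min_branch:
  assumes a: "(a \<longlongrightarrow> a') F" and b: "(b \<longlongrightarrow> b') F" and zero: "min a' b' = (0::real)"
  shows "\<forall>\<^sub>F z in F. if a z \<le> b z then a' = 0 else b' = 0"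
proof -
  have less: "\<forall>\<^sub>F z in F. p z < q z"
    if "(p \<longlongrightarrow> p') F" "(q \<longlongrightarrow> q') F" "p' < q'" for p q :: "'a \<Rightarrow> real" and p' q'
  proof -
    have "\<forall>\<^sub>F z in F. 0 < q z - p z"
      using tendsto_diff[OF that(2,1)] by (rule order_tendstoD) (use that(3) in simp)
    then show ?thesis by eventually_elim simp
  qed
  consider "a' = 0" "b' = 0" | "a' = 0" "0 < b'" | "0 < a'" "b' = 0"
    using zero by linarith
  then show ?thesis
  proof cases
    case 2
    then have "\<forall>\<^sub>F z in F. a z < b z"
      by (intro less[OF a b]) simp
    then show ?thesis by eventually_elim (simp add: 2)
  next
    case 3
    then have "\<forall>\<^sub>F z in F. b z < a z"
      by (intro less[OF b a]) simp
    then show ?thesis by eventually_elim (simp add: 3)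
  qed simp
qed

text \<open>The pattern \<open>i\<close> may change with \<open>k\<close>, but there are only finitely many. If each of them had a member
  with nonzero limit, these members would all exceed \<open>\<rho>\<close> eventually. This replaces the passage to
  subsequences with a constant pattern.\<close>

lemma limit_of_vanishing_family:
  fixes t :: "'j \<Rightarrow> 'a \<Rightarrow> real"
  assumes fin: "finite I" and nontriv: "F \<noteq> bot"
    and ev: "\<forall>\<^sub>F k in F. \<exists>i\<in>I. \<forall>j\<in>J i. \<bar>t j k\<bar> \<le> \<rho> k"
    and t: "\<And>j. (t j \<longlongrightarrow> t' j) F" and \<rho>: "(\<rho> \<longlongrightarrow> 0) F"
  shows "\<exists>i\<in>I. \<forall>j\<in>J i. t' j = 0"
proof (rule ccontr)
  assume contra: "\<not> ?thesis"
  have "\<forall>\<^sub>F k in F. \<exists>j\<in>J i. \<rho> k < \<bar>t j k\<bar>" if "i \<in> I" for i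
  proof -
    have "\<not> (\<forall>j\<in>J i. t' j = 0)"
      using contra that by meson
    then obtain j where j: "j \<in> J i" "t' j \<noteq> 0"
      by auto
    have "((\<lambda>k. \<bar>t j k\<bar> - \<rho> k) \<longlongrightarrow> \<bar>t' j\<bar> - 0) F"
      by (rule tendsto_diff[OF tendsto_rabs[OF t] \<rho>])
    then have "\<forall>\<^sub>F k in F. 0 < \<bar>t j k\<bar> - \<rho> k"
      by (rule order_tendstoD) (use j in simp)
    then show ?thesis
      by eventually_elim (use j in auto)
  qed
  then have "\<forall>\<^sub>F k in F. \<forall>i\<in>I. \<exists>j\<in>J i. \<rho> k < \<bar>t j k\<bar>"
    using fin by (intro eventually_ball_finite) auto
  with ev have "\<forall>\<^sub>F k in F. False"
    by eventually_elim (meson not_le)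
  with nontriv show False by simp
qed

section \<open>Orders of magnitude of norms\<close>

lemma norm_add_bigo:
  assumes "(\<lambda>z. norm (p z)) \<in> O[F](M)" "(\<lambda>z. norm (q z)) \<in> O[F](M :: _ \<Rightarrow> real)"
  shows "(\<lambda>z. norm (p z + q z)) \<in> O[F](M)"
  by (rule landau_o.big_trans[OF _ sum_in_bigo(1)[OF assms]])
    (simp add: landau_o.big_mono norm_triangle_ineq)

lemma norm_diff_bigo:
  assumes "(\<lambda>z. norm (p z)) \<in> O[F](M)" "(\<lambda>z. norm (q z)) \<in> O[F](M :: _ \<Rightarrow> real)"
  shows "(\<lambda>z. norm (p z - q z)) \<in> O[F](M)"
  by (rule landau_o.big_trans[OF _ sum_in_bigo(1)[OF assms]])
    (simp add: landau_o.big_mono norm_triangle_ineq4)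

lemma norm_sum_bigo:
  assumes "\<And>i. i \<in> I \<Longrightarrow> (\<lambda>z. norm (p i z)) \<in> O[F](M :: _ \<Rightarrow> real)"
  shows "(\<lambda>z. norm (\<Sum>i\<in>I. p i z)) \<in> O[F](M)"
  by (rule landau_o.big_trans[OF _ big_sum_in_bigo[OF assms]])
    (simp_all add: landau_o.big_mono sum_nonneg norm_sum)

lemma norm_vec_bigo:
  fixes p :: "'z \<Rightarrow> ('b::real_normed_vector)^'k"
  assumes "\<And>i. (\<lambda>z. norm (p z $ i)) \<in> O[F](M :: _ \<Rightarrow> real)"
  shows "(\<lambda>z. norm (p z)) \<in> O[F](M)"
proof (rule landau_o.big_trans)
  show "(\<lambda>z. norm (p z)) \<in> O[F](\<lambda>z. \<Sum>i\<in>UNIV. norm (p z $ i))"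
    by (intro landau_o.big_mono always_eventually)
      (simp add: norm_vec_def L2_set_le_sum sum_nonneg)
  show "(\<lambda>z. \<Sum>i\<in>UNIV. norm (p z $ i)) \<in> O[F](M)"
    by (intro big_sum_in_bigo assms)
qed

lemma norm_Pair_bigo:
  assumes "(\<lambda>z. norm (p z)) \<in> O[F](M)" "(\<lambda>z. norm (q z)) \<in> O[F](M :: _ \<Rightarrow> real)"
  shows "(\<lambda>z. norm (p z, q z)) \<in> O[F](M)"
  by (rule landau_o.big_trans[OF _ sum_in_bigo(1)[OF assms]])
    (simp add: landau_o.big_mono norm_Pair_le)

lemma norm_fst_component_le: "norm (fst p) \<le> norm p"
  by (metis norm_fst_le prod.collapse)

lemma norm_snd_component_le: "norm (snd p) \<le> norm p"
  by (metis norm_snd_le prod.collapse)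

text \<open>The gradient is weighted by the limit \<open>cb\<close> but the Hessian by the current weights \<open>c z\<close>, as in the
  first row of the Newton residual. Replacing \<open>c z\<close> by \<open>cb\<close> costs a product of the two small factors
  \<open>c z - cb\<close> and \<open>x z - xb\<close>.\<close>

lemma weighted_grad_err_bigo:
  fixes u :: "real^'n \<Rightarrow> real^'k" and c :: "'z::real_normed_vector \<Rightarrow> real^'k" and M :: "'z \<Rightarrow> real"
  assumes u: "twice_cont_diff_vec u" and x: "(x \<longlongrightarrow> xb) (nhds zb)"
    and xd: "\<And>z. norm (x z - xb) \<le> norm (z - zb)" and cd: "\<And>z. norm (c z - cb) \<le> norm (z - zb)"
    and square: "(\<lambda>z. (norm (z - zb))\<^sup>2) \<in> O[nhds zb](M)"
    and err: "\<And>i. (\<lambda>z. norm (grad_err (\<lambda>y. u y $ i) xb (x z))) \<in> O[nhds zb](M)"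
  shows "(\<lambda>z. norm (wgrad cb u (x z) - wgrad cb u xb - whess (c z) u (x z) *v (x z - xb)))
    \<in> O[nhds zb](M)"
proof -
  let ?E = "\<lambda>i z. grad_err (\<lambda>y. u y $ i) xb (x z)" and ?H = "\<lambda>i z. hess (\<lambda>y. u y $ i) (x z)"
  have eq: "wgrad cb u (x z) - wgrad cb u xb - whess (c z) u (x z) *v (x z - xb) =
      (\<Sum>i\<in>UNIV. cb $ i *\<^sub>R ?E i z - (c z - cb) $ i *\<^sub>R (?H i z *v (x z - xb)))" for z
    unfolding wgrad_def whess_def grad_err_def
    by (simp add: bounded_bilinear.sum_left[OF bounded_bilinear_matrix_vector_mult]
        sum_subtractf[symmetric] algebra_simps flip: scaleR_matrix_vector_assoc)
  have "(\<lambda>z. norm (cb $ i *\<^sub>R ?E i z)) \<in> O[nhds zb](M)" for i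
    using err[of i] by simp
  moreover have "(\<lambda>z. norm ((c z - cb) $ i *\<^sub>R (?H i z *v (x z - xb)))) \<in> O[nhds zb](M)" for i
  proof (rule landau_o.big_trans[OF bigoI square])
    let ?K = "norm (hess (\<lambda>y. u y $ i) xb) + 1"
    have "twice_cont_diff (\<lambda>y. u y $ i)"
      using u by (simp add: twice_cont_diff_vec_def)
    then have "((\<lambda>z. norm (?H i z)) \<longlongrightarrow> norm (hess (\<lambda>y. u y $ i) xb)) (nhds zb)"
      by (intro tendsto_norm isCont_tendsto_compose[OF isCont_hess] x)
    then have "\<forall>\<^sub>F z in nhds zb. norm (?H i z) < ?K"
      by (rule order_tendstoD) simp
    then show "\<forall>\<^sub>F z in nhds zb. norm (norm ((c z - cb) $ i *\<^sub>R (?H i z *v (x z - xb))))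
        \<le> ?K * norm ((norm (z - zb))\<^sup>2)"
    proof eventually_elim
      case (elim z)
      have "norm (?H i z *v (x z - xb)) \<le> ?K * norm (z - zb)"
        using elim xd[of z] by (intro order_trans[OF norm_matrix_vector_mult_le] mult_mono) auto
      moreover have "\<bar>(c z - cb) $ i\<bar> \<le> norm (z - zb)"
        using component_le_norm_cart cd order_trans by blast
      ultimately have "\<bar>(c z - cb) $ i\<bar> * norm (?H i z *v (x z - xb)) \<le> norm (z - zb) * (?K * norm (z - zb))"
        by (intro mult_mono) auto
      then show ?case
        by (simp add: power2_eq_square mult_ac)
    qed
  qed
  ultimately show ?thesis
    unfolding eq by (intro norm_sum_bigo norm_diff_bigo)
qed

section \<open>The Newton system at an M-stationary point\<close>

lemma outer_mult: "outer u v *v x = (v \<bullet> x) *\<^sub>R u"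
  by (simp add: outer_def matrix_vector_mult_def vec_eq_iff inner_vec_def sum_distrib_left mult_ac)

locale smooth_mpcc =
  fixes f :: "real^'n \<Rightarrow> real" and g :: "real^'n \<Rightarrow> real^'l" and h :: "real^'n \<Rightarrow> real^'m"
    and G H :: "real^'n \<Rightarrow> real^'p"
  assumes smooth: "twice_cont_diff f" "twice_cont_diff_vec g" "twice_cont_diff_vec h"
    "twice_cont_diff_vec G" "twice_cont_diff_vec H"
begin

abbreviation Hess_L :: "real^'l \<Rightarrow> real^'m \<Rightarrow> real^'p \<Rightarrow> real^'p \<Rightarrow> real^'n \<Rightarrow> real^'n^'n" where
  "Hess_L lam \<eta> \<mu> \<nu> x \<equiv> hess f x + whess lam g x + whess \<eta> h x + whess \<mu> G x + whess \<nu> H x"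

abbreviation comp_deriv :: "(real^'n \<Rightarrow> real^'k) \<Rightarrow> 'k \<Rightarrow> real^'n \<Rightarrow> real^'n \<Rightarrow> real" where
  "comp_deriv u i x d \<equiv> grad (\<lambda>y. u y $ i) x \<bullet> d"

lemma newton_F_eq:
  "newton_F f g h G H (x, lam, \<eta>, \<mu>, \<nu>) =
    (grad f x + wgrad lam g x + wgrad \<eta> h x + wgrad \<mu> G x + wgrad \<nu> H x,
     (\<chi> i. min (- (g x $ i)) (lam $ i)), h x,
     (\<chi> i. phi (G x $ i) (H x $ i) (\<mu> $ i) (\<nu> $ i)))"
  by (simp add: grad_Lagr smooth pi_min_def)

lemma newton_DF_eq:
  "newton_DF f g h G H (x, lam, \<eta>, \<mu>, \<nu>) (dx, dlam, d\<eta>, d\<mu>, d\<nu>) =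
    (Hess_L lam \<eta> \<mu> \<nu> x *v dx + wgrad dlam g x + wgrad d\<eta> h x + wgrad d\<mu> G x + wgrad d\<nu> H x,
     (\<chi> i. if - (g x $ i) \<le> lam $ i then - comp_deriv g i x dx else dlam $ i),
     (\<chi> i. comp_deriv h i x dx),
     (\<chi> i. Dphi (G x $ i) (H x $ i) (\<mu> $ i) (\<nu> $ i) *v
        vec4 (comp_deriv G i x dx) (comp_deriv H i x dx) (d\<mu> $ i) (d\<nu> $ i)))"
proof -
  have row2: "A1 g x lam *v dx + A2 g x lam *v dlam =
      (\<chi> i. if - (g x $ i) \<le> lam $ i then - comp_deriv g i x dx else dlam $ i)"
    by (simp add: vec_eq_iff matrix_vector_mul_component A1_def A2_def Da_pi_min_def Db_pi_min_def
        inner_axis')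
  have col: "M *v vec4 p q r s = p *\<^sub>R column 1 M + q *\<^sub>R column 2 M + r *\<^sub>R column 3 M + s *\<^sub>R column 4 M"
    for M :: "real^4^2" and p q r s
    by (simp add: vec_eq_iff matrix_vector_mult_def sum_4 column_def mult.commute)
  have row4: "stacked_mv (A3 G H x \<mu> \<nu>) dx + stacked_mv (A4 G H x \<mu> \<nu>) d\<mu> + stacked_mv (A5 G H x \<mu> \<nu>) d\<nu> =
      (\<chi> i. Dphi (G x $ i) (H x $ i) (\<mu> $ i) (\<nu> $ i) *v
        vec4 (comp_deriv G i x dx) (comp_deriv H i x dx) (d\<mu> $ i) (d\<nu> $ i))"
    by (simp add: vec_eq_iff[where 'b='p] stacked_mv_def A3_def A4_def A5_def col outer_mult
        matrix_vector_mult_add_rdistrib inner_axis')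
  have row3: "jacobian h (at x) *v dx = (\<chi> i. comp_deriv h i x dx)"
    by (simp add: vec_eq_iff jacobian_mult_nth smooth)
  show ?thesis
    unfolding newton_DF.simps row2 row3 row4 hess_Lagr[OF smooth] 
      transpose_jacobian_mult[OF smooth(2)] transpose_jacobian_mult[OF smooth(3)]
      transpose_jacobian_mult[OF smooth(4)] transpose_jacobian_mult[OF smooth(5)]
    by (rule refl)
qed

lemma linear_newton_DF: "linear (newton_DF f g h G H z)"
proof -
  obtain x lam \<eta> \<mu> \<nu> where z: "z = (x, lam, \<eta>, \<mu>, \<nu>)"
    by (metis prod_cases5)
  note mv = matrix_vector_right_distrib matrix_vector_mult_scaleR
  show ?thesis
  proof (rule linearI)
    fix v w :: "('n, 'l, 'm, 'p) primal_dual" and c :: real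
    show "newton_DF f g h G H z (v + w) = newton_DF f g h G H z v + newton_DF f g h G H z w"
      by (cases v rule: prod_cases5; cases w rule: prod_cases5)
        (simp add: z mv stacked_mv_def vec_eq_iff[where 'b='p] algebra_simps)
    show "newton_DF f g h G H z (c *\<^sub>R v) = c *\<^sub>R newton_DF f g h G H z v"
      by (cases v rule: prod_cases5)
        (simp add: z mv stacked_mv_def vec_eq_iff[where 'b='p] algebra_simps)
  qed
qed

end

locale M_stationary_mpcc = smooth_mpcc f g h G H
  for f :: "real^'n \<Rightarrow> real" and g :: "real^'n \<Rightarrow> real^'l" and h :: "real^'n \<Rightarrow> real^'m"
    and G H :: "real^'n \<Rightarrow> real^'p" +
  fixes xb :: "real^'n" and lb :: "real^'l" and eb :: "real^'m" and mb nb :: "real^'p"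
  assumes feas: "feasible g h G H xb" and mult: "(lb, eb, mb, nb) \<in> M_multipliers f g h G H xb"
begin

abbreviation zb :: "('n, 'l, 'm, 'p) primal_dual" where
  "zb \<equiv> (xb, lb, eb, mb, nb)"

lemma stationary: "grad f xb + wgrad lb g xb + wgrad eb h xb + wgrad mb G xb + wgrad nb H xb = 0"
  using mult by (simp add: M_multipliers_def grad_Lagr smooth)

lemma h_zero: "h xb = 0"
  using feas by (simp add: feasible_def)

lemma min_zero: "min (- (g xb $ i)) (lb $ i) = 0"
proof -
  have "g xb $ i \<le> 0"
    using feas by (simp add: feasible_def)
  moreover have "if g xb $ i = 0 then lb $ i \<ge> 0 else lb $ i = 0"
    using mult by (auto simp: M_multipliers_def I_g_def)
  ultimately show ?thesis
    by (auto simp: min_def split: if_splits)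
qed

lemma complementary: "G xb $ i \<ge> 0" "H xb $ i \<ge> 0" "G xb $ i * H xb $ i = 0"
proof -
  have nonneg: "G xb $ j \<ge> 0" "H xb $ j \<ge> 0" for j
    using feas by (simp_all add: feasible_def)
  have "(\<Sum>j\<in>UNIV. G xb $ j * H xb $ j) = 0"
    using feas by (simp add: feasible_def inner_vec_def)
  then show "G xb $ i * H xb $ i = 0"
    by (simp add: sum_nonneg_eq_0_iff nonneg)
qed (use feas in \<open>simp_all add: feasible_def\<close>)

lemma phi1_zero: "phi1 (G xb $ i) (H xb $ i) (mb $ i) (nb $ i) = 0"
proof (rule phi1_eq_0_if_M_complementary)
  show "G xb $ i > 0 \<Longrightarrow> mb $ i = 0" "H xb $ i > 0 \<Longrightarrow> nb $ i = 0"
    "G xb $ i = 0 \<Longrightarrow> H xb $ i = 0 \<Longrightarrow> mb $ i * nb $ i = 0 \<or> mb $ i < 0 \<and> nb $ i < 0"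
    using mult complementary[of i] by (auto simp: M_multipliers_def I_p0_def I_0p_def I_00_def)
qed (rule complementary)+

text \<open>The hypotheses describe a direction in a limit of the kernels of the Newton matrices. Its
  primal part is critical. Taking the inner product of the first row with \<open>dx\<close> removes all
  multiplier terms, because in each of them one factor vanishes; the remaining quadratic form
  gives \<open>dx = 0\<close> by the second-order condition. What is left of the first row is a linear combination
  of active constraint gradients, hence trivial by the constraint qualification.\<close>

lemma kernel_trivial:
  assumes LICQ: "MPCC_LICQ g h G H xb" and SSOC: "MPCC_SSOC f g h G H xb lb eb mb nb"
    and stat: "Hess_L lb eb mb nb xb *v dx + wgrad dlam g xb + wgrad d\<eta> h xb + wgrad d\<mu> G xb + wgrad d\<nu> H xb = 0"
    and ineq: "\<And>i. g xb $ i = 0 \<and> comp_deriv g i xb dx = 0 \<or> lb $ i = 0 \<and> dlam $ i = 0"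
    and eq: "\<And>i. comp_deriv h i xb dx = 0"
    and pair: "\<And>i. \<exists>P\<in>selectable. (\<forall>j\<in>P. vec4 (G xb $ i) (H xb $ i) (mb $ i) (nb $ i) $ j = 0) \<and>
      (\<forall>j\<in>P. vec4 (comp_deriv G i xb dx) (comp_deriv H i xb dx) (d\<mu> $ i) (d\<nu> $ i) $ j = 0)"
  shows "dx = 0" "dlam = 0" "d\<eta> = 0" "d\<mu> = 0" "d\<nu> = 0"
proof -
  have compl: "comp_deriv G i xb dx * comp_deriv H i xb dx = 0"
      "comp_deriv G i xb dx * d\<mu> $ i = 0" "comp_deriv H i xb dx * d\<nu> $ i = 0"
      "mb $ i \<noteq> 0 \<or> H xb $ i \<noteq> 0 \<Longrightarrow> comp_deriv G i xb dx = 0"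
      "nb $ i \<noteq> 0 \<or> G xb $ i \<noteq> 0 \<Longrightarrow> comp_deriv H i xb dx = 0"
      "H xb $ i \<noteq> 0 \<Longrightarrow> d\<nu> $ i = 0" "G xb $ i \<noteq> 0 \<Longrightarrow> d\<mu> $ i = 0" for i
  proof -
    obtain P where P: "P \<in> selectable" "\<forall>j\<in>P. vec4 (G xb $ i) (H xb $ i) (mb $ i) (nb $ i) $ j = 0"
      "\<forall>j\<in>P. vec4 (comp_deriv G i xb dx) (comp_deriv H i xb dx) (d\<mu> $ i) (d\<nu> $ i) $ j = 0"
      using pair[of i] by auto
    note coords = selectable_coordinates[OF P]
    show "comp_deriv G i xb dx * comp_deriv H i xb dx = 0" "comp_deriv G i xb dx * d\<mu> $ i = 0"
      "comp_deriv H i xb dx * d\<nu> $ i = 0" "mb $ i \<noteq> 0 \<or> H xb $ i \<noteq> 0 \<Longrightarrow> comp_deriv G i xb dx = 0"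
      "nb $ i \<noteq> 0 \<or> G xb $ i \<noteq> 0 \<Longrightarrow> comp_deriv H i xb dx = 0"
      "H xb $ i \<noteq> 0 \<Longrightarrow> d\<nu> $ i = 0" "G xb $ i \<noteq> 0 \<Longrightarrow> d\<mu> $ i = 0"
      by (fact coords)+
  qed
  have crit: "dx \<in> critical_directions g h G H xb lb mb nb"
    unfolding critical_directions_def
    using ineq eq compl(1,4,5)
    by (fastforce simp: vec_eq_iff jacobian_mult_nth smooth I_0p_def I_p0_def I_00_mu_def I_00_nu_def)
  have ineq0: "dlam $ i * comp_deriv g i xb dx = 0" for i
    using ineq[of i] by auto
  have orth: "wgrad dlam g xb \<bullet> dx = 0" "wgrad d\<eta> h xb \<bullet> dx = 0"
    "wgrad d\<mu> G xb \<bullet> dx = 0" "wgrad d\<nu> H xb \<bullet> dx = 0"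
    using compl(2,3) unfolding wgrad_inner by (intro sum.neutral ballI; simp add: ineq0 eq mult.commute)+
  have "dx \<bullet> (Hess_L lb eb mb nb xb *v dx) =
      (Hess_L lb eb mb nb xb *v dx + wgrad dlam g xb + wgrad d\<eta> h xb + wgrad d\<mu> G xb + wgrad d\<nu> H xb) \<bullet> dx"
    by (simp only: inner_add_left orth add_0_right) (rule inner_commute)
  then have "dx \<bullet> (Hess_L lb eb mb nb xb *v dx) = 0"
    by (simp only: stat inner_zero_left)
  then show dx: "dx = 0"
    using SSOC crit unfolding MPCC_SSOC_def by (force simp: hess_Lagr smooth)
  let ?A = "I_0p G H xb \<union> I_00 G H xb" and ?B = "I_p0 G H xb \<union> I_00 G H xb"
  let ?I = "I_g g xb <+> ((UNIV :: 'm set) <+> (?A <+> ?B))"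
  define c where "c r = (case r of Inl i \<Rightarrow> dlam $ i | Inr (Inl i) \<Rightarrow> d\<eta> $ i
    | Inr (Inr (Inl i)) \<Rightarrow> d\<mu> $ i | Inr (Inr (Inr i)) \<Rightarrow> d\<nu> $ i)" for r :: "'l + ('m + ('p + 'p))"
  have supp: "i \<notin> I_g g xb \<Longrightarrow> dlam $ i = 0" "j \<notin> ?A \<Longrightarrow> d\<mu> $ j = 0" "j \<notin> ?B \<Longrightarrow> d\<nu> $ j = 0" for i j
    using ineq[of i] compl(6,7)[of j] complementary[of j]
    by (auto simp: I_g_def I_0p_def I_p0_def I_00_def)
  have row: "row i (jacobian u (at xb)) = grad (\<lambda>y. u y $ i) xb" if "twice_cont_diff_vec u" for u i
    using that by (simp add: row_def jacobian_row)
  have "(\<Sum>r\<in>?I. c r *\<^sub>R stacked_jacobian g h G H xb $ r) =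
      (\<Sum>i\<in>I_g g xb. dlam $ i *\<^sub>R grad (\<lambda>y. g y $ i) xb) + (wgrad d\<eta> h xb +
      ((\<Sum>i\<in>?A. d\<mu> $ i *\<^sub>R grad (\<lambda>y. G y $ i) xb) + (\<Sum>i\<in>?B. d\<nu> $ i *\<^sub>R grad (\<lambda>y. H y $ i) xb)))"
    by (simp add: sum.Plus stacked_jacobian_def c_def row smooth wgrad_def)
  also have "(\<Sum>i\<in>I_g g xb. dlam $ i *\<^sub>R grad (\<lambda>y. g y $ i) xb) = wgrad dlam g xb"
    unfolding wgrad_def by (rule sum.mono_neutral_left) (auto simp: supp)
  also have "(\<Sum>i\<in>?A. d\<mu> $ i *\<^sub>R grad (\<lambda>y. G y $ i) xb) = wgrad d\<mu> G xb"
    unfolding wgrad_def by (rule sum.mono_neutral_left) (use supp in auto)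
  also have "(\<Sum>i\<in>?B. d\<nu> $ i *\<^sub>R grad (\<lambda>y. H y $ i) xb) = wgrad d\<nu> H xb"
    unfolding wgrad_def by (rule sum.mono_neutral_left) (use supp in auto)
  also have "wgrad dlam g xb + (wgrad d\<eta> h xb + (wgrad d\<mu> G xb + wgrad d\<nu> H xb)) = 0"
    using stat by (simp add: dx algebra_simps)
  finally have c0: "c r = 0" if "r \<in> ?I" for r
    using LICQ that unfolding MPCC_LICQ_def by (intro full_row_rank_onD)
  have "dlam $ i = 0" for i
    using supp(1)[of i] c0[of "Inl i"] by (cases "i \<in> I_g g xb") (auto simp: c_def)
  moreover have "d\<eta> $ i = 0" for i
    using c0[of "Inr (Inl i)"] by (auto simp: c_def)
  moreover have "d\<mu> $ i = 0" for i
    using supp(2)[of i] c0[of "Inr (Inr (Inl i))"] by (cases "i \<in> ?A") (auto simp: c_def)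
  moreover have "d\<nu> $ i = 0" for i
    using supp(3)[of i] c0[of "Inr (Inr (Inr i))"] by (cases "i \<in> ?B") (auto simp: c_def)
  ultimately show "dlam = 0" "d\<eta> = 0" "d\<mu> = 0" "d\<nu> = 0"
    by (simp_all add: vec_eq_iff)
qed

text \<open>All data of the Newton system are continuous except for the selections made by
  \<^const>\<open>Da_pi_min\<close>, \<^const>\<open>Db_pi_min\<close> and \<^const>\<open>Dphi\<close>. Near the solution each selection picks only
  coordinates that vanish there, and the selected coordinates of the direction tend to zero
  with the residual.\<close>

lemma newton_DF_limits_injective:
  fixes z :: "nat \<Rightarrow> ('n, 'l, 'm, 'p) primal_dual"
  assumes LICQ: "MPCC_LICQ g h G H xb" and SSOC: "MPCC_SSOC f g h G H xb lb eb mb nb"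
    and z: "z \<longlonglongrightarrow> zb" and v: "v \<longlonglongrightarrow> w" and lim: "(\<lambda>k. newton_DF f g h G H (z k) (v k)) \<longlonglongrightarrow> 0"
  shows "w = 0"
proof -
  define x where "x k = fst (z k)" for k
  define lam where "lam k = fst (snd (z k))" for k
  define \<eta> where "\<eta> k = fst (snd (snd (z k)))" for k
  define \<mu> where "\<mu> k = fst (snd (snd (snd (z k))))" for k
  define \<nu> where "\<nu> k = snd (snd (snd (snd (z k))))" for k
  define dx where "dx k = fst (v k)" for k
  define dlam where "dlam k = fst (snd (v k))" for k
  define d\<eta> where "d\<eta> k = fst (snd (snd (v k)))" for k
  define d\<mu> where "d\<mu> k = fst (snd (snd (snd (v k))))" for k
  define d\<nu> where "d\<nu> k = snd (snd (snd (snd (v k))))" for k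
  obtain wx wl we wm wn where w: "w = (wx, wl, we, wm, wn)"
    by (metis prod_cases5)
  have zk: "z k = (x k, lam k, \<eta> k, \<mu> k, \<nu> k)" and vk: "v k = (dx k, dlam k, d\<eta> k, d\<mu> k, d\<nu> k)" for k
    by (simp_all add: x_def lam_def \<eta>_def \<mu>_def \<nu>_def dx_def dlam_def d\<eta>_def d\<mu>_def d\<nu>_def)
  have zl: "x \<longlonglongrightarrow> xb" "lam \<longlonglongrightarrow> lb" "\<eta> \<longlonglongrightarrow> eb" "\<mu> \<longlonglongrightarrow> mb" "\<nu> \<longlonglongrightarrow> nb"
    using tendsto_fst[OF z] tendsto_fst[OF tendsto_snd[OF z]] tendsto_fst[OF tendsto_snd[OF tendsto_snd[OF z]]]
      tendsto_fst[OF tendsto_snd[OF tendsto_snd[OF tendsto_snd[OF z]]]]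
      tendsto_snd[OF tendsto_snd[OF tendsto_snd[OF tendsto_snd[OF z]]]]
    by (simp_all add: zk)
  have vl: "dx \<longlonglongrightarrow> wx" "dlam \<longlonglongrightarrow> wl" "d\<eta> \<longlonglongrightarrow> we" "d\<mu> \<longlonglongrightarrow> wm" "d\<nu> \<longlonglongrightarrow> wn"
    using tendsto_fst[OF v] tendsto_fst[OF tendsto_snd[OF v]] tendsto_fst[OF tendsto_snd[OF tendsto_snd[OF v]]]
      tendsto_fst[OF tendsto_snd[OF tendsto_snd[OF tendsto_snd[OF v]]]]
      tendsto_snd[OF tendsto_snd[OF tendsto_snd[OF tendsto_snd[OF v]]]]
    by (simp_all add: vk w)
  note lim' = lim[unfolded zk vk newton_DF_eq]
  have comp_deriv_lim: "(\<lambda>k. comp_deriv u i (x k) (dx k)) \<longlonglongrightarrow> comp_deriv u i xb wx" if "twice_cont_diff_vec u"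
    for u :: "real^'n \<Rightarrow> real^'k" and i
    by (intro tendsto_inner tendsto_grad_component that zl vl)
  have hess_lim: "(\<lambda>k. Hess_L (lam k) (\<eta> k) (\<mu> k) (\<nu> k) (x k)) \<longlonglongrightarrow> Hess_L lb eb mb nb xb"
    by (intro tendsto_add tendsto_whess isCont_tendsto_compose[OF isCont_hess] smooth zl)
  have "(\<lambda>k. Hess_L (lam k) (\<eta> k) (\<mu> k) (\<nu> k) (x k) *v dx k + wgrad (dlam k) g (x k) + wgrad (d\<eta> k) h (x k)
      + wgrad (d\<mu> k) G (x k) + wgrad (d\<nu> k) H (x k)) \<longlonglongrightarrow>
      Hess_L lb eb mb nb xb *v wx + wgrad wl g xb + wgrad we h xb + wgrad wm G xb + wgrad wn H xb"
    by (rule tendsto_add[OF tendsto_add[OF tendsto_add[OF tendsto_add[OF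
        tendsto_matrix_vector_mult[OF hess_lim vl(1)]]]]]) (intro tendsto_wgrad smooth zl vl)+
  moreover have "(\<lambda>k. Hess_L (lam k) (\<eta> k) (\<mu> k) (\<nu> k) (x k) *v dx k + wgrad (dlam k) g (x k)
      + wgrad (d\<eta> k) h (x k) + wgrad (d\<mu> k) G (x k) + wgrad (d\<nu> k) H (x k)) \<longlonglongrightarrow> 0"
    using tendsto_fst[OF lim'] by simp
  ultimately have stat: "Hess_L lb eb mb nb xb *v wx + wgrad wl g xb + wgrad we h xb + wgrad wm G xb
      + wgrad wn H xb = 0"
    using LIMSEQ_unique by blast
  have eq: "comp_deriv h i xb wx = 0" for i
  proof -
    have "(\<lambda>k. comp_deriv h i (x k) (dx k)) \<longlonglongrightarrow> 0"
      using tendsto_vec_nth[OF tendsto_fst[OF tendsto_snd[OF tendsto_snd[OF lim']]], of i] by simp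
    then show ?thesis
      using comp_deriv_lim[OF smooth(3), of i] LIMSEQ_unique by blast
  qed
  have ineq: "g xb $ i = 0 \<and> comp_deriv g i xb wx = 0 \<or> lb $ i = 0 \<and> wl $ i = 0" for i
  proof -
    define \<rho> where "\<rho> k = \<bar>if - (g (x k) $ i) \<le> lam k $ i then - comp_deriv g i (x k) (dx k) else dlam k $ i\<bar>" for k
    have \<rho>: "\<rho> \<longlonglongrightarrow> 0"
      using tendsto_rabs[OF tendsto_vec_nth[OF tendsto_fst[OF tendsto_snd[OF lim']], of i]]
      by (simp add: \<rho>_def[abs_def])
    have "\<forall>\<^sub>F k in sequentially. if - (g (x k) $ i) \<le> lam k $ i then - (g xb $ i) = 0 else lb $ i = 0"
      by (rule eventually_pi_min_branch[OF tendsto_minus[OF tendsto_component] tendsto_vec_nth])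
        (rule smooth zl min_zero)+
    \<comment> \<open>The index True stands for the branch of the constraint, False for that of its multiplier.\<close>
    then have ev: "\<forall>\<^sub>F k in sequentially. \<exists>b\<in>{b. if b then g xb $ i = 0 else lb $ i = 0}. \<forall>j\<in>{b}.
        \<bar>if j then comp_deriv g i (x k) (dx k) else dlam k $ i\<bar> \<le> \<rho> k"
    proof eventually_elim
      case (elim k)
      then show ?case
        by (intro bexI[of _ "- (g (x k) $ i) \<le> lam k $ i"]) (auto simp: \<rho>_def)
    qed
    have "\<exists>b\<in>{b. if b then g xb $ i = 0 else lb $ i = 0}. \<forall>j\<in>{b}.
        (if j then comp_deriv g i xb wx else wl $ i) = 0"
    proof (rule limit_of_vanishing_family[OF _ _ ev _ \<rho>])
      show "(\<lambda>k. if j then comp_deriv g i (x k) (dx k) else dlam k $ i) \<longlonglongrightarrow>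
          (if j then comp_deriv g i xb wx else wl $ i)" for j
        using comp_deriv_lim[OF smooth(2)] tendsto_vec_nth[OF vl(2)] by simp
    qed simp_all
    then show ?thesis
      by (auto split: if_splits)
  qed
  have pair: "\<exists>P\<in>selectable. (\<forall>j\<in>P. vec4 (G xb $ i) (H xb $ i) (mb $ i) (nb $ i) $ j = 0) \<and>
      (\<forall>j\<in>P. vec4 (comp_deriv G i xb wx) (comp_deriv H i xb wx) (wm $ i) (wn $ i) $ j = 0)" for i
  proof -
    let ?t = "\<lambda>k. vec4 (comp_deriv G i (x k) (dx k)) (comp_deriv H i (x k) (dx k)) (d\<mu> k $ i) (d\<nu> k $ i)"
    let ?w = "vec4 (G xb $ i) (H xb $ i) (mb $ i) (nb $ i)"
    define \<rho> where "\<rho> k = norm (Dphi (G (x k) $ i) (H (x k) $ i) (\<mu> k $ i) (\<nu> k $ i) *v ?t k)" for k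
    have \<rho>: "\<rho> \<longlonglongrightarrow> 0"
      using tendsto_norm[OF tendsto_vec_nth[OF tendsto_snd[OF tendsto_snd[OF tendsto_snd[OF lim']]], of i]]
      by (simp add: \<rho>_def[abs_def])
    have "\<forall>\<^sub>F k in sequentially. \<exists>P\<in>selectable. (\<forall>j\<in>P. ?w $ j = 0) \<and>
        (\<forall>t. \<forall>j\<in>P. \<bar>t $ j\<bar> \<le> norm (Dphi (G (x k) $ i) (H (x k) $ i) (\<mu> k $ i) (\<nu> k $ i) *v t)) \<and>
        (\<forall>t. norm (Dphi (G (x k) $ i) (H (x k) $ i) (\<mu> k $ i) (\<nu> k $ i) *v t) \<le> (\<Sum>j\<in>P. \<bar>t $ j\<bar>))"
      by (intro eventually_Dphi_active_pair tendsto_component tendsto_vec_nth smooth zl phi1_zero)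
    then have ev: "\<forall>\<^sub>F k in sequentially. \<exists>P\<in>{P\<in>selectable. \<forall>j\<in>P. ?w $ j = 0}. \<forall>j\<in>P. \<bar>?t k $ j\<bar> \<le> \<rho> k"
      by eventually_elim (auto simp: \<rho>_def)
    have "\<exists>P\<in>{P\<in>selectable. \<forall>j\<in>P. ?w $ j = 0}.
        \<forall>j\<in>P. vec4 (comp_deriv G i xb wx) (comp_deriv H i xb wx) (wm $ i) (wn $ i) $ j = 0"
    proof (rule limit_of_vanishing_family[OF _ _ ev _ \<rho>])
      show "(\<lambda>k. ?t k $ j) \<longlonglongrightarrow> vec4 (comp_deriv G i xb wx) (comp_deriv H i xb wx) (wm $ i) (wn $ i) $ j" for j
        using exhaust_4[of j] comp_deriv_lim[OF smooth(4)] comp_deriv_lim[OF smooth(5)]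
          tendsto_vec_nth[OF vl(4)] tendsto_vec_nth[OF vl(5)] by auto
    qed (simp_all add: selectable_def)
    then show ?thesis by auto
  qed
  show "w = 0"
    using kernel_trivial[OF LICQ SSOC stat ineq eq pair] by (simp add: w zero_prod_def)
qed

text \<open>In the last block, \<open>phi = Dphi *v w\<close> at the point \<open>w\<close> of the iterate, and the selected rows annihilate
  the corresponding point of the solution. Hence only the Taylor remainders of the arguments of
  \<^const>\<open>phi\<close> are left, and these are quadratic; the second and third blocks behave alike. The
  first block contributes the remainders of the gradients. Stating the bound for an arbitrary gauge \<open>M\<close>
  covers superlinear and quadratic convergence at once.\<close>

lemma newton_residual_bigo:
  fixes M :: "('n, 'l, 'm, 'p) primal_dual \<Rightarrow> real"
  assumes square: "(\<lambda>z. (norm (z - zb))\<^sup>2) \<in> O[nhds zb](M)"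
    and err_f: "(\<lambda>z. norm (grad_err f xb (fst z))) \<in> O[nhds zb](M)"
    and err_g: "\<And>i. (\<lambda>z. norm (grad_err (\<lambda>y. g y $ i) xb (fst z))) \<in> O[nhds zb](M)"
    and err_h: "\<And>i. (\<lambda>z. norm (grad_err (\<lambda>y. h y $ i) xb (fst z))) \<in> O[nhds zb](M)"
    and err_G: "\<And>i. (\<lambda>z. norm (grad_err (\<lambda>y. G y $ i) xb (fst z))) \<in> O[nhds zb](M)"
    and err_H: "\<And>i. (\<lambda>z. norm (grad_err (\<lambda>y. H y $ i) xb (fst z))) \<in> O[nhds zb](M)"
  shows "(\<lambda>z. norm (newton_F f g h G H z - newton_DF f g h G H z (z - zb))) \<in> O[nhds zb](M)"
proof -
  define x :: "('n, 'l, 'm, 'p) primal_dual \<Rightarrow> _" where "x z = fst z" for z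
  define lam :: "('n, 'l, 'm, 'p) primal_dual \<Rightarrow> _" where "lam z = fst (snd z)" for z
  define \<eta> :: "('n, 'l, 'm, 'p) primal_dual \<Rightarrow> _" where "\<eta> z = fst (snd (snd z))" for z
  define \<mu> :: "('n, 'l, 'm, 'p) primal_dual \<Rightarrow> _" where "\<mu> z = fst (snd (snd (snd z)))" for z
  define \<nu> :: "('n, 'l, 'm, 'p) primal_dual \<Rightarrow> _" where "\<nu> z = snd (snd (snd (snd z)))" for z
  note defs = x_def lam_def \<eta>_def \<mu>_def \<nu>_def
  have id: "((\<lambda>z. z) \<longlongrightarrow> zb) (nhds zb)"
    by (rule filterlim_ident)
  have zl: "(x \<longlongrightarrow> xb) (nhds zb)" "(lam \<longlongrightarrow> lb) (nhds zb)" "(\<mu> \<longlongrightarrow> mb) (nhds zb)" "(\<nu> \<longlongrightarrow> nb) (nhds zb)"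
    using tendsto_fst[OF id] tendsto_fst[OF tendsto_snd[OF id]]
      tendsto_fst[OF tendsto_snd[OF tendsto_snd[OF tendsto_snd[OF id]]]]
      tendsto_snd[OF tendsto_snd[OF tendsto_snd[OF tendsto_snd[OF id]]]]
    by (simp_all add: defs[abs_def])
  have zeq: "z = (x z, lam z, \<eta> z, \<mu> z, \<nu> z)"
    "z - zb = (x z - xb, lam z - lb, \<eta> z - eb, \<mu> z - mb, \<nu> z - nb)" for z
    by (simp_all add: defs prod_eq_iff)
  have dist_le: "norm (x z - xb) \<le> norm (z - zb)" "norm (lam z - lb) \<le> norm (z - zb)"
      "norm (\<eta> z - eb) \<le> norm (z - zb)" "norm (\<mu> z - mb) \<le> norm (z - zb)"
      "norm (\<nu> z - nb) \<le> norm (z - zb)" for z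
    using norm_fst_component_le[of "z - zb"] norm_fst_component_le[of "snd (z - zb)"] norm_fst_component_le[of "snd (snd (z - zb))"]
      norm_fst_component_le[of "snd (snd (snd (z - zb)))"] norm_snd_component_le[of "z - zb"] norm_snd_component_le[of "snd (z - zb)"]
      norm_snd_component_le[of "snd (snd (z - zb))"] norm_snd_component_le[of "snd (snd (snd (z - zb)))"]
    unfolding zeq(2) fst_conv snd_conv by linarith+
  have val: "(\<lambda>z. val_err (\<lambda>y. u y $ i) xb (x z)) \<in> O[nhds zb](M)" if "twice_cont_diff_vec u"
    for u :: "real^'n \<Rightarrow> real^'k" and i
  proof (rule landau_o.big_trans[OF landau_o.big.compose[OF val_err_bigo zl(1)]])
    show "twice_cont_diff (\<lambda>y. u y $ i)"
      using that by (simp add: twice_cont_diff_vec_def)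
    show "(\<lambda>z. (norm (x z - xb))\<^sup>2) \<in> O[nhds zb](M)"
      by (rule landau_o.big_trans[OF _ square]) (simp add: landau_o.big_mono power_mono dist_le)
  qed

  let ?R1 = "\<lambda>z. grad_err f xb (x z)
      + (wgrad lb g (x z) - wgrad lb g xb - whess (lam z) g (x z) *v (x z - xb))
      + (wgrad eb h (x z) - wgrad eb h xb - whess (\<eta> z) h (x z) *v (x z - xb))
      + (wgrad mb G (x z) - wgrad mb G xb - whess (\<mu> z) G (x z) *v (x z - xb))
      + (wgrad nb H (x z) - wgrad nb H xb - whess (\<nu> z) H (x z) *v (x z - xb))"
  let ?R2 = "\<lambda>z. \<chi> i. min (- (g (x z) $ i)) (lam z $ i)
      - (if - (g (x z) $ i) \<le> lam z $ i then - comp_deriv g i (x z) (x z - xb) else lam z $ i - lb $ i)"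
  let ?R3 = "\<lambda>z. \<chi> i. h (x z) $ i - comp_deriv h i (x z) (x z - xb)"
  let ?D = "\<lambda>i z. Dphi (G (x z) $ i) (H (x z) $ i) (\<mu> z $ i) (\<nu> z $ i)"
  let ?q = "\<lambda>i z. vec4 (G (x z) $ i) (H (x z) $ i) (\<mu> z $ i) (\<nu> z $ i)"
  let ?dq = "\<lambda>i z. vec4 (comp_deriv G i (x z) (x z - xb)) (comp_deriv H i (x z) (x z - xb)) (\<mu> z $ i - mb $ i) (\<nu> z $ i - nb $ i)"
  let ?R4 = "\<lambda>z. \<chi> i. ?D i z *v (?q i z - ?dq i z)"
  have eq: "newton_F f g h G H z - newton_DF f g h G H z (z - zb) = (?R1 z, ?R2 z, ?R3 z, ?R4 z)" for z
  proof -
    have F: "newton_F f g h G H z = newton_F f g h G H (x z, lam z, \<eta> z, \<mu> z, \<nu> z)"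
      and DF: "newton_DF f g h G H z (z - zb) = newton_DF f g h G H (x z, lam z, \<eta> z, \<mu> z, \<nu> z)
        (x z - xb, lam z - lb, \<eta> z - eb, \<mu> z - mb, \<nu> z - nb)"
      using zeq by metis+
    have "grad f (x z) + wgrad (lam z) g (x z) + wgrad (\<eta> z) h (x z) + wgrad (\<mu> z) G (x z) + wgrad (\<nu> z) H (x z)
        - (Hess_L (lam z) (\<eta> z) (\<mu> z) (\<nu> z) (x z) *v (x z - xb) + wgrad (lam z - lb) g (x z)
          + wgrad (\<eta> z - eb) h (x z) + wgrad (\<mu> z - mb) G (x z) + wgrad (\<nu> z - nb) H (x z)) =
        ?R1 z + (grad f xb + wgrad lb g xb + wgrad eb h xb + wgrad mb G xb + wgrad nb H xb)"
      unfolding wgrad_diff matrix_vector_mult_add_rdistrib grad_err_def by (simp add: algebra_simps)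
    then show ?thesis
      unfolding F DF newton_F_eq newton_DF_eq stationary add_0_right
      by (simp add: vec_eq_iff[where 'b="'l"] vec_eq_iff[where 'b="'m"] vec_eq_iff[where 'b="'p"]
          phi_eq_Dphi_mult matrix_vector_mult_diff_distrib)
  qed
  have R1: "(\<lambda>z. norm (?R1 z)) \<in> O[nhds zb](M)"
    using err_f err_g err_h err_G err_H
    by (intro norm_add_bigo weighted_grad_err_bigo smooth zl dist_le square) (simp_all add: x_def)
  have R2: "(\<lambda>z. norm (?R2 z)) \<in> O[nhds zb](M)"
  proof (rule norm_vec_bigo)
    fix i
    have "\<forall>\<^sub>F z in nhds zb. if - (g (x z) $ i) \<le> lam z $ i then - (g xb $ i) = 0 else lb $ i = 0"
      by (rule eventually_pi_min_branch[OF tendsto_minus[OF tendsto_component] tendsto_vec_nth])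
        (rule smooth zl min_zero)+
    then have "\<forall>\<^sub>F z in nhds zb. norm (norm (?R2 z $ i)) \<le> norm (val_err (\<lambda>y. g y $ i) xb (x z))"
      by eventually_elim (auto simp: val_err_def min_def split: if_splits)
    then show "(\<lambda>z. norm (?R2 z $ i)) \<in> O[nhds zb](M)"
      by (rule landau_o.big_trans[OF landau_o.big_mono val[OF smooth(2)]])
  qed
  have R3: "(\<lambda>z. norm (?R3 z)) \<in> O[nhds zb](M)"
    using val[OF smooth(3)] h_zero by (intro norm_vec_bigo) (simp add: val_err_def)
  have R4: "(\<lambda>z. norm (?R4 z)) \<in> O[nhds zb](M)"
  proof (rule norm_vec_bigo)
    fix i
    let ?e = "\<lambda>z. \<bar>val_err (\<lambda>y. G y $ i) xb (x z)\<bar> + \<bar>val_err (\<lambda>y. H y $ i) xb (x z)\<bar>"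
    let ?w = "vec4 (G xb $ i) (H xb $ i) (mb $ i) (nb $ i)"
    have "\<forall>\<^sub>F z in nhds zb. \<exists>P\<in>selectable. (\<forall>j\<in>P. ?w $ j = 0) \<and>
        (\<forall>t. \<forall>j\<in>P. \<bar>t $ j\<bar> \<le> norm (?D i z *v t)) \<and> (\<forall>t. norm (?D i z *v t) \<le> (\<Sum>j\<in>P. \<bar>t $ j\<bar>))"
      by (intro eventually_Dphi_active_pair tendsto_component tendsto_vec_nth smooth zl phi1_zero)
    then have "\<forall>\<^sub>F z in nhds zb. norm (norm (?R4 z $ i)) \<le> norm (?e z)"
    proof eventually_elim
      case (elim z)
      then obtain P where P: "P \<in> selectable" "\<forall>j\<in>P. ?w $ j = 0"
        "\<And>t. norm (?D i z *v t) \<le> (\<Sum>j\<in>P. \<bar>t $ j\<bar>)"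
        by blast
      have "norm (?D i z *v (?q i z - ?dq i z)) \<le> (\<Sum>j\<in>P. \<bar>(?q i z - ?dq i z) $ j\<bar>)"
        by (rule P(3))
      \<comment> \<open>The selected coordinates vanish at the solution. Subtracting its point there
        turns the coordinates into Taylor remainders, which are zero for the multipliers.\<close>
      also have "\<dots> = (\<Sum>j\<in>P. \<bar>(?q i z - ?dq i z - ?w) $ j\<bar>)"
        using P(2) by (intro sum.cong) simp_all
      also have "\<dots> \<le> (\<Sum>j\<in>UNIV. \<bar>(?q i z - ?dq i z - ?w) $ j\<bar>)"
        by (rule sum_mono2) simp_all
      also have "\<dots> = ?e z"
        by (simp add: sum_4 val_err_def)
      finally show ?case by simp
    qed
    moreover have "?e \<in> O[nhds zb](M)"
      using val[OF smooth(4), of i] val[OF smooth(5), of i] by (intro sum_in_bigo) simp_all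
    ultimately show "(\<lambda>z. norm (?R4 z $ i)) \<in> O[nhds zb](M)"
      by (rule landau_o.big_trans[OF landau_o.big_mono])
  qed
  show ?thesis
    unfolding eq by (intro norm_Pair_bigo R1 R2 R3 R4)
qed

lemma tendsto_fst_nhds: "(fst \<longlongrightarrow> xb) (nhds zb)"
  using tendsto_fst[OF filterlim_ident[of "nhds zb"]] by simp

lemma newton_residual_quadratic:
  assumes "loc_lipschitz_hess f" "loc_lipschitz_hess_vec g" "loc_lipschitz_hess_vec h"
    "loc_lipschitz_hess_vec G" "loc_lipschitz_hess_vec H"
  shows "(\<lambda>z. norm (newton_F f g h G H z - newton_DF f g h G H z (z - zb)))
    \<in> O[nhds zb](\<lambda>z. (norm (z - zb))\<^sup>2)"
proof -
  have "(\<lambda>z. norm (grad_err u xb (fst z))) \<in> O[nhds zb](\<lambda>z. (norm (z - zb))\<^sup>2)"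
    if "twice_cont_diff u" "loc_lipschitz_hess u" for u
  proof (rule landau_o.big_trans[OF landau_o.big.compose[OF grad_err_bigo[OF that] tendsto_fst_nhds]])
    have "norm (fst z - xb) \<le> norm (z - zb)" for z
      using norm_fst_component_le[of "z - zb"] by simp
    then show "(\<lambda>z. (norm (fst z - xb))\<^sup>2) \<in> O[nhds zb](\<lambda>z. (norm (z - zb))\<^sup>2)"
      by (intro landau_o.big_mono always_eventually) (simp add: power_mono)
  qed
  then show ?thesis
    using smooth assms unfolding twice_cont_diff_vec_def loc_lipschitz_hess_vec_def
    by (intro newton_residual_bigo) auto
qed

text \<open>The gauge is the sum of all gradient remainders and the squared distance, which is of smaller order than the distance.\<close>

lemma newton_residual_superlinear:
  "(\<lambda>z. norm (newton_F f g h G H z - newton_DF f g h G H z (z - zb))) \<in> o[nhds zb](\<lambda>z. norm (z - zb))"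
proof -
  define e where "e u z = norm (grad_err u xb (fst z))" for u and z :: "('n, 'l, 'm, 'p) primal_dual"
  let ?g = "\<lambda>i y. g y $ i" and ?h = "\<lambda>i y. h y $ i" and ?G = "\<lambda>i y. G y $ i" and ?H = "\<lambda>i y. H y $ i"
  define M where "M z = (norm (z - zb))\<^sup>2 + e f z + (\<Sum>i\<in>UNIV. e (?g i) z) + (\<Sum>i\<in>UNIV. e (?h i) z)
    + (\<Sum>i\<in>UNIV. e (?G i) z) + (\<Sum>i\<in>UNIV. e (?H i) z)" for z
  have e_nonneg: "e u z \<ge> 0" for u z
    by (simp add: e_def)
  have "e u \<in> o[nhds zb](\<lambda>z. norm (z - zb))" if "twice_cont_diff u" for u
    unfolding e_def
  proof (rule landau_o.small_big_trans[OF landau_o.small.compose[OF grad_err_smallo[OF that] tendsto_fst_nhds]])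
    have "norm (fst z - xb) \<le> norm (z - zb)" for z
      using norm_fst_component_le[of "z - zb"] by simp
    then show "(\<lambda>z. norm (fst z - xb)) \<in> O[nhds zb](\<lambda>z. norm (z - zb))"
      by (intro landau_o.big_mono always_eventually) simp
  qed
  moreover have "(\<lambda>z. (norm (z - zb))\<^sup>2) \<in> o[nhds zb](\<lambda>z. norm (z - zb))"
  proof (rule landau_o.smallI)
    fix c :: real assume "c > 0"
    then have "\<forall>\<^sub>F z in nhds zb. dist z zb < c"
      by (auto simp: eventually_nhds_metric)
    then show "\<forall>\<^sub>F z in nhds zb. norm ((norm (z - zb))\<^sup>2) \<le> c * norm (norm (z - zb))"
      by eventually_elim (simp add: power2_eq_square dist_norm mult_right_mono)
  qed
  ultimately have M: "M \<in> o[nhds zb](\<lambda>z. norm (z - zb))"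
    unfolding M_def using smooth unfolding twice_cont_diff_vec_def
    by (intro sum_in_smallo big_sum_in_smallo) auto
  have sums_nonneg: "0 \<le> (\<Sum>i\<in>UNIV. e (?g i) z)" "0 \<le> (\<Sum>i\<in>UNIV. e (?h i) z)"
      "0 \<le> (\<Sum>i\<in>UNIV. e (?G i) z)" "0 \<le> (\<Sum>i\<in>UNIV. e (?H i) z)" for z
    by (simp_all add: sum_nonneg e_nonneg)
  have M_ge: "(norm (z - zb))\<^sup>2 \<le> M z" "e f z \<le> M z" "(\<Sum>i\<in>UNIV. e (?g i) z) \<le> M z"
      "(\<Sum>i\<in>UNIV. e (?h i) z) \<le> M z" "(\<Sum>i\<in>UNIV. e (?G i) z) \<le> M z" "(\<Sum>i\<in>UNIV. e (?H i) z) \<le> M z" for z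
    unfolding M_def using sums_nonneg[of z] e_nonneg[of f z] zero_le_power2[of "norm (z - zb)"]
    by linarith+
  have le: "p \<in> O[nhds zb](M)" if "\<And>z. p z \<le> M z" "\<And>z. 0 \<le> p z" for p
    using that by (intro landau_o.big_mono always_eventually) (simp add: order_trans[OF _ abs_ge_self])
  have member: "e (u i) z \<le> (\<Sum>i\<in>UNIV. e (u i) z)" for u :: "'k::finite \<Rightarrow> _" and i z
    by (rule member_le_sum) (simp_all add: e_nonneg)
  have "(\<lambda>z. norm (newton_F f g h G H z - newton_DF f g h G H z (z - zb))) \<in> O[nhds zb](M)"
  proof (rule newton_residual_bigo)
    show "(\<lambda>z. (norm (z - zb))\<^sup>2) \<in> O[nhds zb](M)"
      by (rule le[OF M_ge(1) zero_le_power2])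
    show "(\<lambda>z. norm (grad_err f xb (fst z))) \<in> O[nhds zb](M)"
      unfolding e_def[symmetric] by (rule le[OF M_ge(2) e_nonneg])
    show "(\<lambda>z. norm (grad_err (?g i) xb (fst z))) \<in> O[nhds zb](M)" for i
      unfolding e_def[symmetric] by (rule le[OF order_trans[OF member M_ge(3)] e_nonneg])
    show "(\<lambda>z. norm (grad_err (?h i) xb (fst z))) \<in> O[nhds zb](M)" for i
      unfolding e_def[symmetric] by (rule le[OF order_trans[OF member M_ge(4)] e_nonneg])
    show "(\<lambda>z. norm (grad_err (?G i) xb (fst z))) \<in> O[nhds zb](M)" for i
      unfolding e_def[symmetric] by (rule le[OF order_trans[OF member M_ge(5)] e_nonneg])
    show "(\<lambda>z. norm (grad_err (?H i) xb (fst z))) \<in> O[nhds zb](M)" for i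
      unfolding e_def[symmetric] by (rule le[OF order_trans[OF member M_ge(6)] e_nonneg])
  qed
  then show ?thesis
    using M by (rule landau_o.big_small_trans)
qed

end

theorem theorem4p2:
  fixes f :: "real^'n \<Rightarrow> real"
    and g :: "real^'n \<Rightarrow> real^'l"
    and h :: "real^'n \<Rightarrow> real^'m"
    and G H :: "real^'n \<Rightarrow> real^'p"
    and xb :: "real^'n" and lb :: "real^'l" and eb :: "real^'m" and mb nb :: "real^'p"
  assumes "twice_cont_diff f"
    and "twice_cont_diff_vec g"
    and "twice_cont_diff_vec h"
    and "twice_cont_diff_vec G"
    and "twice_cont_diff_vec H"
    and "M_stationary f g h G H xb"
    and "MPCC_LICQ g h G H xb"
    and "(lb, eb, mb, nb) \<in> M_multipliers f g h G H xb"
    and "MPCC_SSOC f g h G H xb lb eb mb nb"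
  shows "\<exists>\<delta>>0. \<forall>z0 \<in> cball (xb, lb, eb, mb, nb) \<delta>.
           newton_well_defined f g h G H z0 \<and>
           superlinear_conv (newton_seq f g h G H z0) (xb, lb, eb, mb, nb) \<and>
           (loc_lipschitz_hess f \<and> loc_lipschitz_hess_vec g \<and> loc_lipschitz_hess_vec h \<and>
            loc_lipschitz_hess_vec G \<and> loc_lipschitz_hess_vec H \<longrightarrow>
            quadratic_conv (newton_seq f g h G H z0) (xb, lb, eb, mb, nb))"
proof -
  interpret M_stationary_mpcc f g h G H xb lb eb mb nb
    using assms by unfold_locales (simp_all add: M_stationary_def)
  have "\<exists>c>0. \<forall>\<^sub>F z in nhds zb. \<forall>v. c * norm v \<le> norm (newton_DF f g h G H z v)"
  proof (rule uniform_lower_bound_if_limits_injective)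
    fix z v and w :: "('n, 'l, 'm, 'p) primal_dual"
    assume "z \<longlonglongrightarrow> zb" "v \<longlonglongrightarrow> w" "(\<lambda>k. newton_DF f g h G H (z k) (v k)) \<longlonglongrightarrow> 0"
    then show "w = 0"
      by (rule newton_DF_limits_injective[OF assms(7,9)])
  qed (rule linear_newton_DF)
  then obtain c where "c > 0" and lower: "\<forall>\<^sub>F z in nhds zb. \<forall>v. c * norm v \<le> norm (newton_DF f g h G H z v)"
    by blast
  have dims: "DIM(('n, 'l, 'm, 'p) primal_dual) = DIM(('n, 'l, 'm, 'p) residual)"
    by simp
  from nonsmooth_newton_local_convergence[OF linear_newton_DF dims \<open>c > 0\<close> lower
      newton_residual_superlinear]
  obtain \<delta> where "\<delta> > 0" and \<delta>: "\<forall>zs. zs 0 \<in> cball zb \<delta> \<longrightarrow>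
      (\<forall>k. zs (Suc k) = zs k - inv (newton_DF f g h G H (zs k)) (newton_F f g h G H (zs k))) \<longrightarrow>
      (\<forall>k. bij (newton_DF f g h G H (zs k))) \<and> superlinear_conv zs zb \<and>
      ((\<lambda>z. norm (newton_F f g h G H z - newton_DF f g h G H z (z - zb)))
        \<in> O[nhds zb](\<lambda>z. (norm (z - zb))\<^sup>2) \<longrightarrow> quadratic_conv zs zb)"
    by (elim exE conjE)
  show ?thesis
  proof (intro exI[of _ \<delta>] conjI ballI \<open>\<delta> > 0\<close>)
    fix z0 assume "z0 \<in> cball zb \<delta>"
    then have conv: "(\<forall>k. bij (newton_DF f g h G H (newton_seq f g h G H z0 k))) \<and>
        superlinear_conv (newton_seq f g h G H z0) zb \<and>
        ((\<lambda>z. norm (newton_F f g h G H z - newton_DF f g h G H z (z - zb)))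
          \<in> O[nhds zb](\<lambda>z. (norm (z - zb))\<^sup>2) \<longrightarrow> quadratic_conv (newton_seq f g h G H z0) zb)"
      using \<delta>[rule_format, of "newton_seq f g h G H z0"] by simp
    then show "newton_well_defined f g h G H z0" "superlinear_conv (newton_seq f g h G H z0) zb"
      by (simp_all add: newton_well_defined_def)
    show "loc_lipschitz_hess f \<and> loc_lipschitz_hess_vec g \<and> loc_lipschitz_hess_vec h \<and>
        loc_lipschitz_hess_vec G \<and> loc_lipschitz_hess_vec H \<longrightarrow>
        quadratic_conv (newton_seq f g h G H z0) zb"
      using conv newton_residual_quadratic by blast
  qed
qed

end
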